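(* For every convex open set $U\subseteq\mathbb{R}^n$ and every $k\ge0$, \[H^k_{bs}(U)\cong\begin{cases}\mathbb{R}, & k=\deg U,\\ 0,&\text{otherwise.}\end{cases}\]
   Context: For an open set $U\subseteq\mathbb{R}^n$, $\Omega^k_{bs}(U)$ is the space of smooth $k$-forms on $U$ that vanish outside the ball $B(r)$ of radius $r$ around $0$ for some $r>0$ (boundedly supported forms), and $H^*_{bs}(U)$ is the cohomology of the complex $(\Omega^*_{bs}(U),d)$ with $d$ the exterior derivative. For a convex open $U$, $\mathrm{invdim}\,U:=\dim\mathrm{stab}_{\mathbb{R}^n}(U)$ with $\mathrm{stab}_{\mathbb{R}^n}(U)=\{v: U+v=U\}$ (and $\mathrm{invdim}\,\emptyset=-\infty$); $\deg U:=\mathrm{invdim}\,U$ if the projection of $U$ to $\mathbb{R}^n/\mathrm{stab}_{\mathbb{R}^n}(U)$ is bounded, and $\deg U:=-\infty$ otherwise. *)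

theory Defs
  imports "HOL-Analysis.Analysis"
begin

text \<open>Points of R^n are vectors of type real^'n; n = CARD('n).
  A k-form omega on U is represented by its (antisymmetric) component functions:
  omega x is, for an index list is of length k, is the coefficient omega_{i1...ik}(x),
  so that omega = (1/k!) sum over all index lists of omega_{is} dx^{i1} wedge ... wedge dx^{ik}.
  Components at lists of length other than k, and all values outside U, are 0.\<close>

definition partial :: "'n::finite \<Rightarrow> (real^'n \<Rightarrow> real) \<Rightarrow> real^'n \<Rightarrow> real" where
  "partial j f x = deriv (\<lambda>t. f (x + t *\<^sub>R axis j 1)) 0"

definition smooth_on :: "(real^'n::finite) set \<Rightarrow> (real^'n \<Rightarrow> real) \<Rightarrow> bool" where
  "smooth_on U f \<longleftrightarrow> (\<exists>D :: 'n list \<Rightarrow> real^'n \<Rightarrow> real.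
      D [] = f \<and> (\<forall>js. continuous_on U (D js)) \<and>
      (\<forall>js j. \<forall>x\<in>U. ((\<lambda>t. D js (x + t *\<^sub>R axis j 1)) has_real_derivative D (j # js) x) (at 0)))"

definition alternating :: "('n list \<Rightarrow> real) \<Rightarrow> bool" where
  "alternating c \<longleftrightarrow> (\<forall>is i j. i < length is \<and> j < length is \<and> i \<noteq> j \<longrightarrow>
      c (is[i := is ! j, j := is ! i]) = - c is)"

definition bs_form :: "(real^'n::finite) set \<Rightarrow> nat \<Rightarrow> (real^'n \<Rightarrow> 'n list \<Rightarrow> real) \<Rightarrow> bool" where
  "bs_form U k \<omega> \<longleftrightarrow>
     (\<forall>x is. length is \<noteq> k \<longrightarrow> \<omega> x is = 0) \<and>
     (\<forall>x. x \<notin> U \<longrightarrow> (\<forall>is. \<omega> x is = 0)) \<and>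
     (\<forall>x. alternating (\<omega> x)) \<and>
     (\<forall>is. smooth_on U (\<lambda>x. \<omega> x is)) \<and>
     (\<exists>r>0. \<forall>x\<in>U. x \<notin> ball 0 r \<longrightarrow> (\<forall>is. \<omega> x is = 0))"

definition ext_d :: "(real^'n::finite) set \<Rightarrow> (real^'n \<Rightarrow> 'n list \<Rightarrow> real) \<Rightarrow> real^'n \<Rightarrow> 'n list \<Rightarrow> real" where
  "ext_d U \<omega> x is = (if x \<in> U then
      (\<Sum>m<length is. (-1) ^ m * partial (is ! m) (\<lambda>y. \<omega> y (take m is @ drop (Suc m) is)) x)
    else 0)"

definition closed_bs :: "(real^'n::finite) set \<Rightarrow> nat \<Rightarrow> (real^'n \<Rightarrow> 'n list \<Rightarrow> real) \<Rightarrow> bool" where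
  "closed_bs U k \<omega> \<longleftrightarrow> bs_form U k \<omega> \<and> ext_d U \<omega> = (\<lambda>_ _. 0)"

definition exact_bs :: "(real^'n::finite) set \<Rightarrow> nat \<Rightarrow> (real^'n \<Rightarrow> 'n list \<Rightarrow> real) \<Rightarrow> bool" where
  "exact_bs U k \<omega> \<longleftrightarrow>
     (if k = 0 then \<omega> = (\<lambda>_ _. 0) else (\<exists>\<eta>. bs_form U (k - 1) \<eta> \<and> ext_d U \<eta> = \<omega>))"

definition Hbs_zero :: "(real^'n::finite) set \<Rightarrow> nat \<Rightarrow> bool" where
  "Hbs_zero U k \<longleftrightarrow> (\<forall>\<omega>. closed_bs U k \<omega> \<longrightarrow> exact_bs U k \<omega>)"

text \<open>H^k_bs(U) isomorphic to R (as real vector space), i.e. the quotient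
  closed/exact is one-dimensional: spanned by the class of a non-exact closed form.\<close>
definition Hbs_iso_R :: "(real^'n::finite) set \<Rightarrow> nat \<Rightarrow> bool" where
  "Hbs_iso_R U k \<longleftrightarrow> (\<exists>\<omega>. closed_bs U k \<omega> \<and> \<not> exact_bs U k \<omega> \<and>
      (\<forall>\<theta>. closed_bs U k \<theta> \<longrightarrow> (\<exists>c::real. exact_bs U k (\<lambda>x is. \<theta> x is - c * \<omega> x is))))"

definition stab :: "(real^'n::finite) set \<Rightarrow> (real^'n) set" where
  "stab U = {v. (\<lambda>u. u + v) ` U = U}"

text \<open>deg U, with None standing for -infinity.  The projection of U to R^n/S is bounded
  iff U is contained in B + S for some bounded B.\<close>
definition deg :: "(real^'n::finite) set \<Rightarrow> nat option" where
  "deg U = (if U \<noteq> {} \<and>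
               (\<exists>B. bounded B \<and> U \<subseteq> {b + s | b s. b \<in> B \<and> s \<in> stab U})
            then Some (dim (stab U)) else None)"

end

theory Submission
  imports Defs
begin

text \<open>A recession direction \<open>v\<close> of \<open>U\<close> whose opposite is not one gives a homotopy operator: translation along
  \<open>v\<close> moves all of \<open>U\<close> out of any given ball in bounded time, so integrating \<open>\<iota>\<^sub>v \<omega>\<close> along it
  yields a primitive, and this primitive still has bounded support; hence all cohomology vanishes. If there is no such
  direction, \<open>U\<close> is bounded modulo \<open>S = stab U\<close>. For \<open>v \<noteq> 0\<close> in \<open>S\<close>, the sets
  \<open>P = {x \<in> U. v \<bullet> x > -1}\<close> and \<open>Q = {x \<in> U. v \<bullet> x < 1}\<close> are of the first kind, so by Mayer--Vietoris the
  cohomology of \<open>U = P \<union> Q\<close> is that of the slab \<open>P \<inter> Q\<close> shifted by one. The slab is bounded modulo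
  \<open>S \<inter> v\<^sup>\<bottom>\<close>, which has dimension one less, and induction ends with a bounded convex set, where radial contraction gives
  \<open>\<real>\<close> in degree \<open>0\<close>.\<close>

section \<open>Smooth functions\<close>

text \<open>Bounded support is the obstacle throughout. Contracting an unbounded \<open>U\<close> to
  a point carries distant points into the support, so the usual Poincare primitive need not be
  boundedly supported; a translation over a finite time does no such harm, provided that one time
  serves all of \<open>U\<close>. Hence uniform escape is extracted by compactness, and contraction
  is kept for bounded sets. For \<open>v \<noteq> 0\<close> in \<open>S\<close> no uniform time
  exists on \<open>U\<close>: the point \<open>x - t *\<^sub>R v\<close> needs time \<open>t\<close>
  to come back to \<open>x\<close>, however large \<open>t\<close> is. A half-space cut removes such
  late starting points, which is what makes \<open>P\<close> and \<open>Q\<close> acyclic.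
  Multiplication by a smooth function and restriction to an open subset both preserve bounded
  support, so the cut-off in Mayer--Vietoris may depend on \<open>v \<bullet> x\<close> alone, and
  the sequence runs in the same direction as in ordinary de Rham theory. Smoothness is given only as
  a tower of iterated partial derivatives; directional derivatives, symmetry of mixed partials,
  products and parameter integrals all have to be derived from such towers.\<close>

abbreviation has_partial :: "(real^'n::finite \<Rightarrow> real) \<Rightarrow> 'n \<Rightarrow> real^'n \<Rightarrow> real \<Rightarrow> bool" where
  "has_partial f j x d \<equiv> ((\<lambda>t. f (x + t *\<^sub>R axis j 1)) has_real_derivative d) (at 0)"

lemma has_partial_imp_partial: "has_partial f j x d \<Longrightarrow> partial j f x = d"
  unfolding partial_def by (rule DERIV_imp_deriv)

lemma open_line_preimage:
  fixes x v :: "'a::real_normed_vector"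
  assumes "open V"
  shows "open {t. x + t *\<^sub>R v \<in> V}"
proof -
  have "open ((\<lambda>t. x + t *\<^sub>R v) -` V)"
    by (intro open_vimage assms continuous_intros)
  then show ?thesis by (simp add: vimage_def)
qed

lemma has_partial_cong:
  assumes "open V" "x \<in> V" "\<And>y. y \<in> V \<Longrightarrow> f y = g y" "has_partial f j x d"
  shows "has_partial g j x d"
  using assms
  by (intro has_field_derivative_transform_within_open[OF assms(4) open_line_preimage[OF assms(1)]]) auto

lemma partial_cong:
  assumes "open V" "x \<in> V" "\<And>y. y \<in> V \<Longrightarrow> f y = g y"
  shows "partial j f x = partial j g x"
proof -
  have "has_partial f j x d \<longleftrightarrow> has_partial g j x d" for d
    using has_partial_cong[OF assms(1,2), of f g j d] has_partial_cong[OF assms(1,2), of g f j d] assms(3)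
    by auto
  then show ?thesis by (simp add: partial_def deriv_def)
qed

text \<open>Choosing for each member of \<open>P\<close> a derivative that is again in
  \<open>P\<close>, and iterating along the index list, builds the required tower. To prove
  smoothness it is thus enough to exhibit some class of continuous functions closed under partial
  differentiation.\<close>

lemma smooth_on_coinduct:
  assumes "P f" and "\<And>g. P g \<Longrightarrow> continuous_on U g"
    and "\<And>g j. P g \<Longrightarrow> \<exists>g'. P g' \<and> (\<forall>x\<in>U. has_partial g j x (g' x))"
  shows "smooth_on U f"
proof -
  define nx where "nx g j = (SOME g'. P g' \<and> (\<forall>x\<in>U. has_partial g j x (g' x)))" for g j
  have nx: "P (nx g j) \<and> (\<forall>x\<in>U. has_partial g j x (nx g j x))" if "P g" for g j
    unfolding nx_def by (rule someI_ex[OF assms(3)[OF that]])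
  define D where "D js = foldr (\<lambda>j g. nx g j) js f" for js
  have P: "P (D js)" for js
    by (induction js) (auto simp: D_def assms(1) nx)
  have "D (j # js) = nx (D js) j" for j js by (simp add: D_def)
  then show ?thesis unfolding smooth_on_def
    using P nx assms(2) by (intro exI[of _ D]) (auto simp: D_def)
qed

lemma smooth_on_imp_continuous_on: "smooth_on U f \<Longrightarrow> continuous_on U f"
  unfolding smooth_on_def by metis

lemma smooth_on_has_partial:
  assumes "smooth_on U f"
  shows "\<exists>g. smooth_on U g \<and> (\<forall>x\<in>U. has_partial f j x (g x))"
proof -
  obtain D where D: "D [] = f" "\<And>js. continuous_on U (D js)"
    "\<And>js i x. x \<in> U \<Longrightarrow> has_partial (D js) i x (D (i # js) x)"
    using assms unfolding smooth_on_def by blast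
  have "smooth_on U (D [j])" unfolding smooth_on_def
    \<comment> \<open>\<open>D\<close> records the latest differentiation first, so the tower over
      \<open>D [j]\<close> is indexed by the lists that end in \<open>j\<close>.\<close>
    using D(2) D(3)[of _ "_ @ [j]"] by (intro exI[of _ "\<lambda>js. D (js @ [j])"]) auto
  with D show ?thesis by (intro exI[of _ "D [j]"]) auto
qed

lemma smooth_on_cong:
  assumes "open V" "\<And>x. x \<in> V \<Longrightarrow> f x = g x" "smooth_on V f"
  shows "smooth_on V g"
proof (rule smooth_on_coinduct[where P = "\<lambda>g. \<exists>f. smooth_on V f \<and> (\<forall>x\<in>V. f x = g x)"])
  show "\<exists>f. smooth_on V f \<and> (\<forall>x\<in>V. f x = g x)" using assms by auto
next
  fix g assume "\<exists>f. smooth_on V f \<and> (\<forall>x\<in>V. f x = g x)"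
  then show "continuous_on V g"
    using smooth_on_imp_continuous_on by (metis continuous_on_eq)
next
  fix g j assume "\<exists>f. smooth_on V f \<and> (\<forall>x\<in>V. f x = g x)"
  then obtain f where f: "smooth_on V f" "\<forall>x\<in>V. f x = g x" by blast
  obtain h where h: "smooth_on V h" "\<And>x. x \<in> V \<Longrightarrow> has_partial f j x (h x)"
    using smooth_on_has_partial[OF f(1)] by blast
  have "has_partial g j x (h x)" if "x \<in> V" for x
    using has_partial_cong[OF assms(1) that _ h(2)[OF that], of g] f(2) by blast
  with h(1) show "\<exists>g'. (\<exists>f. smooth_on V f \<and> (\<forall>x\<in>V. f x = g' x)) \<and> (\<forall>x\<in>V. has_partial g j x (g' x))"
    by (intro exI[of _ h]) auto
qed

lemma smooth_on_subset: "smooth_on U f \<Longrightarrow> V \<subseteq> U \<Longrightarrow> smooth_on V f"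
  unfolding smooth_on_def by (elim exE, rule exI, safe) (auto intro: continuous_on_subset)

lemma smooth_on_partial:
  assumes "open U" "smooth_on U f"
  shows "smooth_on U (partial j f)" "x \<in> U \<Longrightarrow> has_partial f j x (partial j f x)"
proof -
  obtain g where g: "smooth_on U g" "\<And>x. x \<in> U \<Longrightarrow> has_partial f j x (g x)"
    using smooth_on_has_partial[OF assms(2)] by blast
  have eq: "g x = partial j f x" if "x \<in> U" for x
    using has_partial_imp_partial[OF g(2)[OF that]] by simp
  show "smooth_on U (partial j f)" by (rule smooth_on_cong[OF assms(1) eq g(1)])
  show "x \<in> U \<Longrightarrow> has_partial f j x (partial j f x)" using g(2)[of x] eq[of x] by simp
qed

lemma smooth_on_locally:
  assumes "\<And>x. x \<in> U \<Longrightarrow> \<exists>V. open V \<and> x \<in> V \<and> smooth_on V f"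
  shows "smooth_on U f"
proof (rule smooth_on_coinduct[where P = "\<lambda>f. \<forall>x\<in>U. \<exists>V. open V \<and> x \<in> V \<and> smooth_on V f"])
  show "\<forall>x\<in>U. \<exists>V. open V \<and> x \<in> V \<and> smooth_on V f" using assms by blast
next
  fix g assume g: "\<forall>x\<in>U. \<exists>V. open V \<and> x \<in> V \<and> smooth_on V g"
  show "continuous_on U g"
  proof (intro continuous_at_imp_continuous_on ballI)
    fix x assume "x \<in> U"
    then obtain V where "open V" "x \<in> V" "smooth_on V g" using g by blast
    then show "isCont g x"
      using smooth_on_imp_continuous_on continuous_on_eq_continuous_at by blast
  qed
  fix j
  have "\<exists>V. open V \<and> x \<in> V \<and> smooth_on V (partial j g) \<and> has_partial g j x (partial j g x)"
    if "x \<in> U" for x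
  proof -
    obtain V where "open V" "x \<in> V" "smooth_on V g" using g \<open>x \<in> U\<close> by blast
    then show ?thesis by (intro exI[of _ V]) (simp add: smooth_on_partial)
  qed
  then show "\<exists>g'. (\<forall>x\<in>U. \<exists>V. open V \<and> x \<in> V \<and> smooth_on V g') \<and> (\<forall>x\<in>U. has_partial g j x (g' x))"
    \<comment> \<open>The neighbourhoods come with unrelated towers; \<open>partial j g\<close> is a
      single function that serves all of them.\<close>
    by (intro exI[of _ "partial j g"]) metis
qed

text \<open>Every function generated below has partial derivatives that are again generated, so the whole
  class is smooth by coinduction; the plain product rule would not stay among products.\<close>

inductive smooth_expr :: "(real^'n::finite) set \<Rightarrow> (real^'n \<Rightarrow> real) \<Rightarrow> bool" for U where
  base: "smooth_on U f \<Longrightarrow> smooth_expr U f"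
| add: "smooth_expr U f \<Longrightarrow> smooth_expr U g \<Longrightarrow> smooth_expr U (\<lambda>x. f x + g x)"
| mult: "smooth_expr U f \<Longrightarrow> smooth_expr U g \<Longrightarrow> smooth_expr U (\<lambda>x. f x * g x)"
| comp: "smooth_on U f \<Longrightarrow>
    (\<And>n x. x \<in> U \<Longrightarrow> (gs n has_real_derivative gs (Suc n) (f x)) (at (f x))) \<Longrightarrow>
    smooth_expr U (\<lambda>x. gs (n::nat) (f x))"

lemma smooth_expr_imp_smooth_on:
  assumes "smooth_expr U f"
  shows "smooth_on U f"
proof (rule smooth_on_coinduct[where P = "smooth_expr U", OF assms])
  fix g assume "smooth_expr U g"
  then show "continuous_on U g"
  proof induction
    case (comp f gs n)
    have "isCont (gs n) (f x)" if "x \<in> U" for x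
      using comp(2)[OF that] DERIV_isCont by blast
    then show ?case
      using smooth_on_imp_continuous_on[OF comp(1)]
      by (simp add: continuous_on_eq_continuous_within)
        (metis continuous_within_compose3)
  qed (simp_all add: smooth_on_imp_continuous_on continuous_on_add continuous_on_mult)
next
  fix g j assume "smooth_expr U g"
  then show "\<exists>g'. smooth_expr U g' \<and> (\<forall>x\<in>U. has_partial g j x (g' x))"
  proof induction
    case (base f)
    then show ?case using smooth_on_has_partial[of U f j] smooth_expr.base by blast
  next
    case (add f g)
    then obtain f' g' where *: "smooth_expr U f'" "smooth_expr U g'"
      "\<forall>x\<in>U. has_partial f j x (f' x)" "\<forall>x\<in>U. has_partial g j x (g' x)" by blast
    show ?case
      by (rule exI[of _ "\<lambda>x. f' x + g' x"])
        (use * in \<open>auto intro!: smooth_expr.add derivative_intros\<close>)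
  next
    case (mult f g)
    then obtain f' g' where *: "smooth_expr U f'" "smooth_expr U g'"
      "\<forall>x\<in>U. has_partial f j x (f' x)" "\<forall>x\<in>U. has_partial g j x (g' x)" by blast
    have "has_partial (\<lambda>x. f x * g x) j x (f' x * g x + g' x * f x)" if "x \<in> U" for x
      using DERIV_mult[of "\<lambda>t. f (x + t *\<^sub>R axis j 1)" "f' x" 0 UNIV "\<lambda>t. g (x + t *\<^sub>R axis j 1)" "g' x"] * that
      by simp
    with * mult(1,2) show ?case
      by (intro exI[of _ "\<lambda>x. f' x * g x + g' x * f x"]) (auto intro!: smooth_expr.add smooth_expr.mult)
  next
    case (comp f gs n)
    obtain f' where f': "smooth_on U f'" "\<And>x. x \<in> U \<Longrightarrow> has_partial f j x (f' x)"
      using smooth_on_has_partial[OF comp(1)] by blast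
    have "has_partial (\<lambda>x. gs n (f x)) j x (gs (Suc n) (f x) * f' x)" if "x \<in> U" for x
      using DERIV_chain2[of "gs n" _ "\<lambda>t. f (x + t *\<^sub>R axis j 1)" 0, OF _ f'(2)[OF that]] comp(2)[OF that, of n]
      by simp
    moreover have "smooth_expr U (\<lambda>x. gs (Suc n) (f x) * f' x)"
      by (rule smooth_expr.mult[OF smooth_expr.comp[where gs = gs, OF comp] smooth_expr.base[OF f'(1)]])
    ultimately show ?case by (intro exI[of _ "\<lambda>x. gs (Suc n) (f x) * f' x"]) auto
  qed
qed

lemma smooth_on_add: "smooth_on U f \<Longrightarrow> smooth_on U g \<Longrightarrow> smooth_on U (\<lambda>x. f x + g x)"
  by (rule smooth_expr_imp_smooth_on[OF smooth_expr.add[OF smooth_expr.base smooth_expr.base]])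

lemma smooth_on_mult: "smooth_on U f \<Longrightarrow> smooth_on U g \<Longrightarrow> smooth_on U (\<lambda>x. f x * g x)"
  by (rule smooth_expr_imp_smooth_on[OF smooth_expr.mult[OF smooth_expr.base smooth_expr.base]])

text \<open>\<open>gs\<close> is the tower of derivatives of the outer function. It is required only
  at values of \<open>f\<close>, which admits outer functions such as the reciprocal.\<close>

lemma smooth_on_comp:
  assumes "smooth_on U f" "\<And>n x. x \<in> U \<Longrightarrow> (gs n has_real_derivative gs (Suc n) (f x)) (at (f x))"
  shows "smooth_on U (\<lambda>x. gs (n::nat) (f x))"
  by (rule smooth_expr_imp_smooth_on[OF smooth_expr.comp[where gs = gs, OF assms]])

lemma smooth_on_const: "smooth_on U (\<lambda>_. c)"
  unfolding smooth_on_def by (intro exI[of _ "\<lambda>js _. if js = [] then c else 0"]) auto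

lemma smooth_on_cmult: "smooth_on U f \<Longrightarrow> smooth_on U (\<lambda>x. c * f x)"
  by (intro smooth_on_mult smooth_on_const)

lemma smooth_on_diff:
  assumes "smooth_on U f" "smooth_on U g" shows "smooth_on U (\<lambda>x. f x - g x)"
  using smooth_on_add[OF assms(1) smooth_on_cmult[OF assms(2), of "-1"]] by simp

lemma smooth_on_sum:
  "(\<And>i. i \<in> A \<Longrightarrow> smooth_on U (f i)) \<Longrightarrow> smooth_on U (\<lambda>x. \<Sum>i\<in>A. f i x)"
  by (induction A rule: infinite_finite_induct) (auto intro: smooth_on_const smooth_on_add)

lemma smooth_on_linear:
  assumes "linear f" shows "smooth_on U f"
  unfolding smooth_on_def
proof (intro exI conjI allI ballI)
  let ?D = "\<lambda>js x. case js of [] \<Rightarrow> f x | [j] \<Rightarrow> f (axis j 1) | _ \<Rightarrow> 0"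
  show "?D [] = f" by simp
  show "continuous_on U (?D js)" for js
    using linear_continuous_on[of f U] assms
    by (cases js; cases "tl js") (auto simp: linear_conv_bounded_linear)
  show "has_partial (?D js) j x (?D (j # js) x)" for js j x
  proof (cases js)
    case Nil
    have "(\<lambda>t. f (x + t *\<^sub>R axis j 1)) = (\<lambda>t. f x + t * f (axis j 1))"
      using assms by (auto simp: linear_add linear_cmul)
    then show ?thesis using Nil by (auto intro!: derivative_eq_intros)
  qed (auto split: list.split)
qed

section \<open>Directional derivatives and symmetry of mixed partials\<close>

lemma has_derivative_along_shift:
  fixes f :: "'a::real_normed_vector \<Rightarrow> real"
  assumes "((\<lambda>t. f ((x + s *\<^sub>R v) + t *\<^sub>R v)) has_real_derivative d) (at 0)"
  shows "((\<lambda>t. f (x + t *\<^sub>R v)) has_real_derivative d) (at s)"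
  using assms DERIV_shift[of "\<lambda>t. f (x + t *\<^sub>R v)" d 0 s]
  by (simp add: algebra_simps scaleR_add_left)

text \<open>The segment is run through as \<open>t * a\<close> with \<open>t\<close> between 0 and
  1, so that \<open>a\<close> may have either sign or be 0.\<close>

lemma partial_MVT:
  fixes f :: "real^'n::finite \<Rightarrow> real"
  assumes "\<And>y. y \<in> V \<Longrightarrow> has_partial f i y (f' y)" "convex V" "x \<in> V" "x + a *\<^sub>R axis i 1 \<in> V"
  shows "\<exists>y\<in>V. f (x + a *\<^sub>R axis i 1) - f x = a * f' y"
proof -
  have V: "x + (t * a) *\<^sub>R axis i 1 \<in> V" if "0 \<le> t" "t \<le> 1" for t
  proof -
    have "x + (t * a) *\<^sub>R axis i 1 = (1 - t) *\<^sub>R x + t *\<^sub>R (x + a *\<^sub>R axis i 1)"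
      by (simp add: algebra_simps)
    then show ?thesis using assms(2-4) that by (simp add: convexD)
  qed
  have D: "((\<lambda>t. f (x + (t * a) *\<^sub>R axis i 1)) has_real_derivative f' (x + (t * a) *\<^sub>R axis i 1) * a) (at t)"
    if "0 \<le> t" "t \<le> 1" for t
  proof -
    have "((\<lambda>s. f (x + s *\<^sub>R axis i 1)) has_real_derivative f' (x + (t * a) *\<^sub>R axis i 1)) (at (t * a))"
      by (rule has_derivative_along_shift[OF assms(1)[OF V[OF that]]])
    moreover have "((\<lambda>t. t * a) has_real_derivative a) (at t)"
      by (auto intro!: derivative_eq_intros)
    ultimately show ?thesis
      using DERIV_chain2[of "\<lambda>s. f (x + s *\<^sub>R axis i 1)" _ "\<lambda>t. t * a" t] by blast
  qed
  obtain t where "0 < t" "t < 1"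
    "f (x + (1 * a) *\<^sub>R axis i 1) - f (x + (0 * a) *\<^sub>R axis i 1) = (1 - 0) * (f' (x + (t * a) *\<^sub>R axis i 1) * a)"
    using MVT2[of 0 1 "\<lambda>t. f (x + (t * a) *\<^sub>R axis i 1)" "\<lambda>t. f' (x + (t * a) *\<^sub>R axis i 1) * a", OF _ D]
    by auto
  then show ?thesis using V[of t] by (intro bexI[of _ "x + (t * a) *\<^sub>R axis i 1"]) auto
qed

lemma smooth_on_near:
  assumes "open U" "smooth_on U f" "x \<in> U" "e > 0"
  shows "\<exists>r>0. ball x r \<subseteq> U \<and> (\<forall>y\<in>ball x r. \<bar>f y - f x\<bar> < e)"
proof -
  obtain r1 where "r1 > 0" "ball x r1 \<subseteq> U" using assms(1,3) openE by blast
  moreover obtain r2 where "r2 > 0" "\<forall>y\<in>U. dist y x < r2 \<longrightarrow> dist (f y) (f x) < e"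
    using smooth_on_imp_continuous_on[OF assms(2)] assms(3,4) unfolding continuous_on_iff by meson
  ultimately show ?thesis
    by (intro exI[of _ "min r1 r2"]) (auto simp: dist_commute dist_real_def subset_eq)
qed

text \<open>Coordinates are added one at a time. Adding coordinate \<open>i\<close> changes the
  increment by \<open>h\<close>, a difference along one axis; the mean value theorem turns
  \<open>h t\<close> into \<open>t * a\<close> times a partial derivative at a point near
  \<open>x\<close>, and continuity of that partial derivative gives the limit.\<close>

lemma smooth_on_directional_derivative:
  fixes f :: "real^'n::finite \<Rightarrow> real"
  assumes U: "open U" "smooth_on U f" "x \<in> U"
  shows "((\<lambda>t. f (x + t *\<^sub>R v)) has_real_derivative (\<Sum>j\<in>UNIV. v $ j * partial j f x)) (at 0)"
proof -
  have "((\<lambda>t. f (x + t *\<^sub>R (\<Sum>j\<in>J. v $ j *\<^sub>R axis j 1))) has_real_derivative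
         (\<Sum>j\<in>J. v $ j * partial j f x)) (at 0)" if "finite J" for J
    using that
  proof induction
    case (insert i J)
    define Y a where "Y = (\<Sum>j\<in>J. v $ j *\<^sub>R axis j (1::real))" and "a = v $ i"
    define h where "h t = f ((x + t *\<^sub>R Y) + (t * a) *\<^sub>R axis i 1) - f (x + t *\<^sub>R Y)" for t
    have "(\<lambda>t. (h t - h 0) / (t - 0)) \<midarrow>0\<rightarrow> a * partial i f x"
    proof (rule LIM_I)
      fix e :: real assume "e > 0"
      then have "e / (\<bar>a\<bar> + 1) > 0" by simp
      from smooth_on_near[OF U(1) smooth_on_partial(1)[OF U(1,2)] U(3) this]
      obtain r where r: "r > 0" "ball x r \<subseteq> U"
        "\<And>y. y \<in> ball x r \<Longrightarrow> \<bar>partial i f y - partial i f x\<bar> < e / (\<bar>a\<bar> + 1)" by blast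
      \<comment> \<open>For \<open>\<bar>t\<bar>\<close> below this bound both end points of the
        axis segment lie in \<open>ball x r\<close>; the summand 1 keeps the denominator
        positive.\<close>
      let ?s = "r / (norm Y + \<bar>a\<bar> + 1)"
      have "norm ((h t - h 0) / (t - 0) - a * partial i f x) < e" if t: "t \<noteq> 0" "norm (t - 0) < ?s" for t
      proof -
        have "\<bar>t\<bar> * (norm Y + \<bar>a\<bar> + 1) < r" using t(2)
          by (simp add: pos_less_divide_eq add_nonneg_pos)
        then have nr: "\<bar>t\<bar> * norm Y + \<bar>t * a\<bar> < r" by (simp add: algebra_simps abs_mult)
        have nr': "norm (t *\<^sub>R Y) < r" "norm (t *\<^sub>R Y + (t * a) *\<^sub>R axis i (1::real)) < r"
          using nr norm_triangle_ineq[of "t *\<^sub>R Y" "(t * a) *\<^sub>R axis i (1::real)"]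
          by auto
        then have "x + t *\<^sub>R Y \<in> ball x r" "x + (t *\<^sub>R Y + (t * a) *\<^sub>R axis i 1) \<in> ball x r"
          using nr' dist_add_cancel[of x 0] by (simp_all only: add_0_right mem_ball dist_0_norm)
        then have B: "x + t *\<^sub>R Y \<in> ball x r" "x + t *\<^sub>R Y + (t * a) *\<^sub>R axis i 1 \<in> ball x r"
          by (simp_all only: add.assoc)
        have "has_partial f i y (partial i f y)" if "y \<in> ball x r" for y
          using smooth_on_partial(2)[OF U(1,2)] r(2) that by blast
        from partial_MVT[OF this convex_ball B]
        obtain y where y: "y \<in> ball x r" "h t = (t * a) * partial i f y"
          unfolding h_def by blast
        have "(h t - h 0) / (t - 0) - a * partial i f x = a * (partial i f y - partial i f x)"
          using t(1) y(2) by (simp add: h_def field_simps)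
        moreover have "\<bar>a\<bar> * \<bar>partial i f y - partial i f x\<bar> \<le> \<bar>a\<bar> * (e / (\<bar>a\<bar> + 1))"
          using r(3)[OF y(1)] by (intro mult_left_mono) auto
        moreover have "\<bar>a\<bar> * (e / (\<bar>a\<bar> + 1)) < e"
          using \<open>e > 0\<close> by (simp add: field_simps)
        ultimately show ?thesis by (simp add: abs_mult)
      qed
      moreover have "?s > 0" using r(1) by (simp add: add_nonneg_pos)
      ultimately show "\<exists>s>0. \<forall>t. t \<noteq> 0 \<and> norm (t - 0) < s \<longrightarrow> norm ((h t - h 0) / (t - 0) - a * partial i f x) < e"
        by blast
    qed
    then have "(h has_real_derivative a * partial i f x) (at 0)"
      by (simp add: has_field_derivative_iff)
    from DERIV_add[OF this insert.IH]
    show ?case using insert.hyps by (simp add: h_def Y_def a_def algebra_simps)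
  qed simp
  from this[of UNIV] show ?thesis
    using basis_expansion[of v] by (simp add: scalar_mult_eq_scaleR)
qed

text \<open>The second difference of \<open>f\<close> over a small square is symmetric in
  \<open>i\<close> and \<open>j\<close>. Two applications of the mean value theorem, in either
  order, express it through either mixed derivative at points near \<open>x\<close>, and continuity
  of both finishes.\<close>

lemma partial_commute:
  fixes f :: "real^'n::finite \<Rightarrow> real"
  assumes U: "open U" "smooth_on U f" "x \<in> U"
  shows "partial i (partial j f) x = partial j (partial i f) x"
proof -
  \<comment> \<open>The side is \<open>r / 4\<close> because the first mean value point is sought in
    the ball of radius \<open>r / 2\<close>, from which a further step of \<open>r / 4\<close> stays
    inside \<open>ball x r\<close>.\<close>
  have 1: "\<exists>z\<in>ball x r. f (x + t *\<^sub>R axis j 1 + t *\<^sub>R axis i 1) - f (x + t *\<^sub>R axis i 1)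
      - f (x + t *\<^sub>R axis j 1) + f x = t * (t * partial j (partial i f) z)"
    if r: "r > 0" "ball x r \<subseteq> U" and t: "t = r / 4" for r t i j
  proof -
    let ?e = "\<lambda>i. axis i (1::real) :: real^'n"
    have in_r: "y + t *\<^sub>R ?e j \<in> ball x r" if "y \<in> ball x (r / 2)" for y
    proof -
      have "dist x (y + t *\<^sub>R ?e j) \<le> dist x y + dist y (y + t *\<^sub>R ?e j)" by (rule dist_triangle)
      moreover have "dist y (y + t *\<^sub>R ?e j) = r / 4" using r(1) t by (simp add: dist_norm)
      ultimately show ?thesis using that r(1) unfolding mem_ball by argo
    qed
    have "has_partial (\<lambda>y. f (y + t *\<^sub>R ?e j) - f y) i y (partial i f (y + t *\<^sub>R ?e j) - partial i f y)"
      if "y \<in> ball x (r / 2)" for y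
    proof -
      have "has_partial f i (y + t *\<^sub>R ?e j) (partial i f (y + t *\<^sub>R ?e j))" "has_partial f i y (partial i f y)"
        using that in_r[OF that] r by (auto intro!: smooth_on_partial(2)[OF U(1,2)])
      from DERIV_diff[OF this] show ?thesis by (simp add: algebra_simps)
    qed
    then obtain y where y: "y \<in> ball x (r / 2)"
      "(f (x + t *\<^sub>R ?e i + t *\<^sub>R ?e j) - f (x + t *\<^sub>R ?e i)) - (f (x + t *\<^sub>R ?e j) - f x)
        = t * (partial i f (y + t *\<^sub>R ?e j) - partial i f y)"
      using partial_MVT[of "ball x (r / 2)" "\<lambda>y. f (y + t *\<^sub>R ?e j) - f y" i
          "\<lambda>y. partial i f (y + t *\<^sub>R ?e j) - partial i f y" x t] r(1) t
      by (auto simp: dist_norm)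
    have "has_partial (partial i f) j z (partial j (partial i f) z)" if "z \<in> ball x r" for z
      using that r(2) by (auto intro!: smooth_on_partial(2)[OF U(1) smooth_on_partial(1)[OF U(1,2)]])
    moreover have "y \<in> ball x r" using y(1) r(1) by auto
    ultimately obtain z where "z \<in> ball x r"
      "partial i f (y + t *\<^sub>R ?e j) - partial i f y = t * partial j (partial i f) z"
      using partial_MVT[of "ball x r" "partial i f" j "partial j (partial i f)" y t] in_r[OF y(1)] by auto
    with y(2) show ?thesis by (auto simp: algebra_simps intro!: bexI[of _ z])
  qed
  have "\<bar>partial i (partial j f) x - partial j (partial i f) x\<bar> < 2 * e" if "e > 0" for e
  proof -
    have sm: "smooth_on U (partial i (partial j f))" "smooth_on U (partial j (partial i f))"
      by (intro smooth_on_partial(1) U)+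
    obtain r1 where r1: "r1 > 0" "ball x r1 \<subseteq> U"
      "\<forall>y\<in>ball x r1. \<bar>partial i (partial j f) y - partial i (partial j f) x\<bar> < e"
      using smooth_on_near[OF U(1) sm(1) U(3) \<open>e > 0\<close>] by blast
    obtain r2 where r2: "r2 > 0"
      "\<forall>y\<in>ball x r2. \<bar>partial j (partial i f) y - partial j (partial i f) x\<bar> < e"
      using smooth_on_near[OF U(1) sm(2) U(3) \<open>e > 0\<close>] by blast
    define r where "r = min r1 r2"
    have r: "r > 0" "ball x r \<subseteq> U" using r1 r2 by (auto simp: r_def)
    obtain z z' where z: "z \<in> ball x r" "z' \<in> ball x r"
      and "r / 4 * (r / 4 * partial j (partial i f) z) = r / 4 * (r / 4 * partial i (partial j f) z')"
      using 1[OF r refl, of j i] 1[OF r refl, of i j] by (auto simp: add_ac algebra_simps)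
    then have "partial j (partial i f) z = partial i (partial j f) z'" using r(1) by simp
    moreover from z have "z \<in> ball x r2" "z' \<in> ball x r1" by (auto simp: r_def)
    then have "\<bar>partial j (partial i f) z - partial j (partial i f) x\<bar> < e"
      "\<bar>partial i (partial j f) z' - partial i (partial j f) x\<bar> < e"
      using r1(3) r2(2) by blast+
    ultimately show ?thesis by linarith
  qed
  \<comment> \<open>With \<open>e\<close> half of the discrepancy, a nonzero discrepancy would be
    smaller than itself.\<close>
  from this[of "\<bar>partial i (partial j f) x - partial j (partial i f) x\<bar> / 2"] show ?thesis by (cases "partial i (partial j f) x = partial j (partial i f) x") auto
qed

section \<open>Differentiation under the integral sign\<close>

lemma
  fixes g :: "real^'n::finite \<Rightarrow> real" and p :: "real \<Rightarrow> real"
  assumes U: "open U" and F: "\<And>x t. x \<in> U \<Longrightarrow> t \<in> {0..T} \<Longrightarrow> (1 + c * t) *\<^sub>R x + t *\<^sub>R w \<in> U"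
    and p: "continuous_on {0..T} p" and g: "smooth_on U g"
  shows has_partial_integral_flow: "x \<in> U \<Longrightarrow>
      has_partial (\<lambda>x. integral {0..T} (\<lambda>t. p t * g ((1 + c * t) *\<^sub>R x + t *\<^sub>R w))) j x
        (integral {0..T} (\<lambda>t. (p t * (1 + c * t)) * partial j g ((1 + c * t) *\<^sub>R x + t *\<^sub>R w)))"
    and continuous_on_integral_flow: "continuous_on U (\<lambda>x. integral {0..T} (\<lambda>t. p t * g ((1 + c * t) *\<^sub>R x + t *\<^sub>R w)))"
proof -
  let ?F = "\<lambda>t x. (1 + c * t) *\<^sub>R x + t *\<^sub>R w"
  have cont: "continuous_on (A \<times> {0..T}) (\<lambda>(s, t). q t * h (?F t (\<phi> s)))"
    if "continuous_on A \<phi>" "\<phi> ` A \<subseteq> U" "continuous_on {0..T} q" "smooth_on U h"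
    for A :: "'b::topological_space set" and \<phi> q and h :: "real^'n \<Rightarrow> real"
  proof -
    have "continuous_on (A \<times> {0..T}) (\<lambda>z. h (?F (snd z) (\<phi> (fst z))))"
      by (rule continuous_on_compose2[OF smooth_on_imp_continuous_on[OF that(4)]])
        (use that F in \<open>auto intro!: continuous_intros continuous_on_compose2[OF that(1)]\<close>)
    moreover have "continuous_on (A \<times> {0..T}) (\<lambda>z. q (snd z))"
      by (rule continuous_on_compose2[OF that(3)]) (auto intro!: continuous_intros)
    ultimately show ?thesis by (simp add: case_prod_unfold continuous_on_mult)
  qed
  show "continuous_on U (\<lambda>x. integral {0..T} (\<lambda>t. p t * g (?F t x)))"
    using integral_continuous_on_param[of U 0 T "\<lambda>x t. p t * g (?F t x)"] cont[of U "\<lambda>x. x" p g] p g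
    by (simp add: cbox_interval)
  assume x: "x \<in> U"
  obtain e where e: "e > 0" "ball x e \<subseteq> U" using U x openE by blast
  have inU: "x + s *\<^sub>R axis j 1 \<in> U" if "s \<in> ball 0 e" for s
  proof -
    have "dist x (x + s *\<^sub>R axis j 1) = \<bar>s\<bar>" by (simp add: dist_norm)
    then show ?thesis using that e(2) by auto
  qed
  have q: "continuous_on {0..T} (\<lambda>t. p t * (1 + c * t))" by (intro continuous_intros p)
  have \<phi>: "continuous_on A (\<lambda>s. x + s *\<^sub>R axis j (1::real))" for A by (intro continuous_intros)
  have D: "((\<lambda>s. p t * g (?F t (x + s *\<^sub>R axis j 1))) has_field_derivative
          (p t * (1 + c * t)) * partial j g (?F t (x + s *\<^sub>R axis j 1))) (at s within ball 0 e)"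
    if s: "s \<in> ball 0 e" and t: "t \<in> cbox 0 T" for s t
  proof -
    let ?a = "1 + c * t"
    have "?F t (x + s *\<^sub>R axis j 1) \<in> U" using F[OF inU[OF s], of t] t by (simp add: cbox_interval)
    then have "has_partial g j (?F t x + (?a * s) *\<^sub>R axis j 1) (partial j g (?F t (x + s *\<^sub>R axis j 1)))"
      using smooth_on_partial(2)[OF U g, of "?F t (x + s *\<^sub>R axis j 1)" j]
      by (simp add: algebra_simps)
    from has_derivative_along_shift[OF this]
    have "((\<lambda>t'. g (?F t x + t' *\<^sub>R axis j 1)) has_real_derivative partial j g (?F t (x + s *\<^sub>R axis j 1))) (at (?a * s))" .
    moreover have "((\<lambda>s. ?a * s) has_real_derivative ?a) (at s)"
      by (auto intro!: derivative_eq_intros)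
    ultimately have "((\<lambda>s. g (?F t x + (?a * s) *\<^sub>R axis j 1)) has_real_derivative
        partial j g (?F t (x + s *\<^sub>R axis j 1)) * ?a) (at s)"
      using DERIV_chain2[of "\<lambda>t'. g (?F t x + t' *\<^sub>R axis j 1)" _ "\<lambda>s. ?a * s" s] by blast
    moreover have "?F t x + (?a * s) *\<^sub>R axis j 1 = ?F t (x + s *\<^sub>R axis j 1)" for s
      by (simp add: algebra_simps)
    ultimately have "((\<lambda>s. g (?F t (x + s *\<^sub>R axis j 1))) has_real_derivative
        partial j g (?F t (x + s *\<^sub>R axis j 1)) * ?a) (at s)" by simp
    from DERIV_cmult[OF this, of "p t"] show ?thesis
      by (rule has_field_derivative_at_within[THEN DERIV_cong]) (simp add: mult_ac)
  qed
  have "((\<lambda>s. integral (cbox 0 T) (\<lambda>t. p t * g (?F t (x + s *\<^sub>R axis j 1)))) has_field_derivative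
     integral (cbox 0 T) (\<lambda>t. (p t * (1 + c * t)) * partial j g (?F t (x + 0 *\<^sub>R axis j 1)))) (at 0 within ball 0 e)"
  proof (rule leibniz_rule_field_derivative[OF D])
    show "continuous_on (ball 0 e \<times> cbox 0 T)
        (\<lambda>(s, t). (p t * (1 + c * t)) * partial j g (?F t (x + s *\<^sub>R axis j 1)))"
      unfolding cbox_interval
      by (rule cont[OF \<phi> image_subsetI[OF inU] q smooth_on_partial(1)[OF U g]])
    fix s :: real assume s: "s \<in> ball 0 e"
    have "continuous_on {0..T} (\<lambda>t. p t * g (?F t (x + s *\<^sub>R axis j 1)))"
      by (intro continuous_on_mult p continuous_on_compose2[OF smooth_on_imp_continuous_on[OF g]] continuous_intros)
        (use F[OF inU[OF s]] in auto)
    then show "(\<lambda>t. p t * g (?F t (x + s *\<^sub>R axis j 1))) integrable_on cbox 0 T"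
      by (simp add: cbox_interval integrable_continuous_real)
  qed (use e in auto)
  then show "has_partial (\<lambda>x. integral {0..T} (\<lambda>t. p t * g (?F t x))) j x
        (integral {0..T} (\<lambda>t. (p t * (1 + c * t)) * partial j g (?F t x)))"
    using e(1) by (simp add: cbox_interval at_within_open[of 0 "ball 0 e"])
qed

text \<open>Differentiation multiplies the weight by the chain rule factor \<open>1 + c * t\<close>.
  Allowing an arbitrary continuous weight \<open>p\<close> makes this class of integrals closed
  under partial derivatives, as coinduction requires.\<close>

lemma smooth_on_integral_flow:
  fixes g :: "real^'n::finite \<Rightarrow> real" and p :: "real \<Rightarrow> real"
  assumes U: "open U" and F: "\<And>x t. x \<in> U \<Longrightarrow> t \<in> {0..T} \<Longrightarrow> (1 + c * t) *\<^sub>R x + t *\<^sub>R w \<in> U"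
    and p: "continuous_on {0..T} p" and g: "smooth_on U g"
  shows "smooth_on U (\<lambda>x. integral {0..T} (\<lambda>t. p t * g ((1 + c * t) *\<^sub>R x + t *\<^sub>R w)))"
proof (rule smooth_on_coinduct[where P = "\<lambda>h. \<exists>p g. continuous_on {0..T} p \<and> smooth_on U g \<and>
    h = (\<lambda>x. integral {0..T} (\<lambda>t. p t * g ((1 + c * t) *\<^sub>R x + t *\<^sub>R w)))"])
  show "\<exists>p' g'. continuous_on {0..T} p' \<and> smooth_on U g' \<and>
    (\<lambda>x. integral {0..T} (\<lambda>t. p t * g ((1 + c * t) *\<^sub>R x + t *\<^sub>R w))) =
    (\<lambda>x. integral {0..T} (\<lambda>t. p' t * g' ((1 + c * t) *\<^sub>R x + t *\<^sub>R w)))"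
    using p g by blast
next
  fix h assume "\<exists>p g. continuous_on {0..T} p \<and> smooth_on U g \<and>
    h = (\<lambda>x. integral {0..T} (\<lambda>t. p t * g ((1 + c * t) *\<^sub>R x + t *\<^sub>R w)))"
  then show "continuous_on U h" using continuous_on_integral_flow[OF U F] by blast
next
  fix h j assume "\<exists>p g. continuous_on {0..T} p \<and> smooth_on U g \<and>
    h = (\<lambda>x. integral {0..T} (\<lambda>t. p t * g ((1 + c * t) *\<^sub>R x + t *\<^sub>R w)))"
  then obtain p g where pg: "continuous_on {0..T} p" "smooth_on U g"
    and h: "h = (\<lambda>x. integral {0..T} (\<lambda>t. p t * g ((1 + c * t) *\<^sub>R x + t *\<^sub>R w)))" by blast
  have "continuous_on {0..T} (\<lambda>t. p t * (1 + c * t))" by (intro continuous_intros pg)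
  then show "\<exists>h'. (\<exists>p g. continuous_on {0..T} p \<and> smooth_on U g \<and>
    h' = (\<lambda>x. integral {0..T} (\<lambda>t. p t * g ((1 + c * t) *\<^sub>R x + t *\<^sub>R w)))) \<and>
    (\<forall>x\<in>U. has_partial h j x (h' x))"
    unfolding h
    using has_partial_integral_flow[OF U F pg, where j = j] smooth_on_partial(1)[OF U pg(2), of j]
    by (intro exI[of _ "\<lambda>x. integral {0..T} (\<lambda>t. (p t * (1 + c * t)) * partial j g ((1 + c * t) *\<^sub>R x + t *\<^sub>R w))"]
        exI[of _ "\<lambda>t. p t * (1 + c * t)"] exI[of _ "partial j g"] conjI ballI) blast+
qed

section \<open>A smooth cut-off function\<close>

text \<open>The recursion for \<open>flat_poly\<close> comes from differentiating \<open>p (1/t) * exp (-1/t)\<close>.\<close>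

fun flat_poly :: "nat \<Rightarrow> real poly" where
  "flat_poly 0 = 1"
| "flat_poly (Suc n) = [:0, 0, 1:] * (flat_poly n - pderiv (flat_poly n))"

text \<open>The \<open>n\<close>-th derivative of the function that is
  \<open>exp (- (1 / t))\<close> for positive \<open>t\<close> and 0 elsewhere.\<close>

definition flat :: "nat \<Rightarrow> real \<Rightarrow> real" where
  "flat n t = (if t > 0 then poly (flat_poly n) (1 / t) * exp (- (1 / t)) else 0)"

lemma poly_div_exp_tendsto_0: "((\<lambda>s. poly p s * exp (- s)) \<longlongrightarrow> (0::real)) at_top"
proof -
  have "((\<lambda>s. \<Sum>i\<le>degree p. coeff p i * (s ^ i / exp s)) \<longlongrightarrow> (\<Sum>i\<le>degree p. coeff p i * 0)) at_top"
    by (intro tendsto_intros tendsto_power_div_exp_0)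
  then show ?thesis by (simp add: poly_altdef exp_minus sum_distrib_right divide_inverse mult.assoc)
qed

lemma flat_has_derivative: "(flat n has_real_derivative flat (Suc n) t) (at t)"
proof -
  consider "t > 0" | "t < 0" | "t = 0" by linarith
  then show ?thesis
  proof cases
    case 1
    let ?p = "flat_poly n"
    have "((\<lambda>t. poly ?p (1 / t) * exp (- (1 / t))) has_real_derivative
        poly (flat_poly (Suc n)) (1 / t) * exp (- (1 / t))) (at t)"
      using 1 by (auto intro!: derivative_eq_intros poly_DERIV[THEN DERIV_chain2]
          simp: field_simps power2_eq_square)
    from has_field_derivative_transform_within_open[OF this open_greaterThan[of 0]] 1
    show ?thesis by (simp add: flat_def)
  next
    case 2
    have "((\<lambda>_. 0) has_real_derivative 0) (at t)" by simp
    from has_field_derivative_transform_within_open[OF this open_lessThan[of 0]] 2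
    show ?thesis by (simp add: flat_def)
  next
    case 3
    have "((\<lambda>h. flat n h / h) \<longlongrightarrow> 0) (at_left 0)"
      by (rule tendsto_eventually) (auto simp: flat_def eventually_at_filter)
    moreover have "((\<lambda>h. flat n h / h) \<longlongrightarrow> 0) (at_right 0)"
    proof (rule Lim_transform_eventually)
      \<comment> \<open>Dividing by \<open>h\<close> is multiplying by \<open>s = 1 / h\<close>,
        which raises the polynomial by the factor \<open>[:0, 1:]\<close>; the exponential still
        wins as \<open>s\<close> tends to infinity.\<close>
      show "((\<lambda>h. poly ([:0, 1:] * flat_poly n) (inverse h) * exp (- (inverse h))) \<longlongrightarrow> 0) (at_right 0)"
        by (rule filterlim_compose[OF poly_div_exp_tendsto_0 filterlim_inverse_at_top_right])
      show "\<forall>\<^sub>F h in at_right 0. poly ([:0, 1:] * flat_poly n) (inverse h) * exp (- (inverse h)) = flat n h / h"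
        by (auto simp: flat_def eventually_at_filter field_simps)
    qed
    ultimately have "((\<lambda>h. flat n h / h) \<longlongrightarrow> 0) (at 0)"
      by (simp add: filterlim_at_split)
    then show ?thesis using 3 by (simp add: has_field_derivative_iff flat_def)
  qed
qed

lemma smooth_on_inverse:
  assumes "smooth_on U f" "\<And>x. x \<in> U \<Longrightarrow> f x \<noteq> 0"
  shows "smooth_on U (\<lambda>x. inverse (f x))"
proof -
  define gs where "gs n t = (-1) ^ n * fact n * inverse t ^ Suc n" for n and t :: real
  have "(gs n has_real_derivative gs (Suc n) t) (at t)" if "t \<noteq> 0" for n t
  proof -
    have "((\<lambda>t. inverse t ^ Suc n) has_real_derivative
        real (Suc n) * inverse t ^ n * (- (inverse t * inverse t))) (at t)"
      using that by (auto intro!: derivative_eq_intros simp del: power_Suc)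
    from DERIV_cmult[OF this, of "(-1) ^ n * fact n"]
    show ?thesis by (simp add: gs_def[abs_def] algebra_simps)
  qed
  then have "smooth_on U (\<lambda>x. gs 0 (f x))"
    using smooth_on_comp[where gs = gs, OF assms(1)] assms(2) by blast
  then show ?thesis by (simp add: gs_def)
qed

text \<open>The arguments \<open>1/2 - t\<close> and \<open>1/2 + t\<close> sum to 1, so one of them
  is positive and the denominator never vanishes. The thresholds lie strictly inside the slab
  between -1 and 1, which leaves room to extend by zero.\<close>

lemma smooth_step:
  obtains \<psi> :: "real \<Rightarrow> real" where "\<And>U (v :: real^'n::finite). smooth_on U (\<lambda>x. \<psi> (v \<bullet> x))"
    "\<And>t. t \<le> - 1/2 \<Longrightarrow> \<psi> t = 1" "\<And>t. t \<ge> 1/2 \<Longrightarrow> \<psi> t = 0"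
proof
  define \<psi> where "\<psi> t = flat 0 (1/2 - t) * inverse (flat 0 (1/2 - t) + flat 0 (1/2 + t))" for t
  show "smooth_on U (\<lambda>x. \<psi> (v \<bullet> x))" for U and v :: "real^'n"
  proof -
    have lin: "smooth_on U (\<lambda>x. v \<bullet> x)"
      by (intro smooth_on_linear) (simp add: linear_iff inner_add_right)
    have f: "smooth_on U (\<lambda>x. flat 0 (1/2 - v \<bullet> x))" and g: "smooth_on U (\<lambda>x. flat 0 (1/2 + v \<bullet> x))"
      by (rule smooth_on_comp[where gs = flat, OF _ flat_has_derivative],
          intro smooth_on_diff smooth_on_add smooth_on_const lin)+
    have nz: "flat 0 (1/2 - t) + flat 0 (1/2 + t) \<noteq> 0" for t
      by (auto simp: flat_def) (smt (verit) exp_gt_zero)+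
    show ?thesis unfolding \<psi>_def
      by (rule smooth_on_mult[OF f smooth_on_inverse[OF smooth_on_add[OF f g] nz]])
  qed
  show "\<psi> t = 1" if "t \<le> -1/2" for t using that by (auto simp: \<psi>_def flat_def)
  show "\<psi> t = 0" if "t \<ge> 1/2" for t using that by (auto simp: \<psi>_def flat_def)
qed

section \<open>The complex of boundedly supported forms\<close>

type_synonym 'n form = "real^'n \<Rightarrow> 'n list \<Rightarrow> real"

section \<open>Index lists and signs\<close>

definition omit :: "nat \<Rightarrow> 'a list \<Rightarrow> 'a list" where
  "omit m xs = take m xs @ drop (Suc m) xs"

definition swap_at :: "nat \<Rightarrow> nat \<Rightarrow> 'a list \<Rightarrow> 'a list" where
  "swap_at i j xs = xs[i := xs ! j, j := xs ! i]"

lemma length_omit [simp]: "m < length xs \<Longrightarrow> length (omit m xs) = length xs - 1"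
  by (simp add: omit_def)

lemma nth_omit: "m < length xs \<Longrightarrow> l < length xs - 1 \<Longrightarrow> omit m xs ! l = (if l < m then xs ! l else xs ! Suc l)"
  by (auto simp: omit_def nth_append)

lemma omit_Cons: "omit 0 (x # xs) = xs" "omit (Suc m) (x # xs) = x # omit m xs"
  by (simp_all add: omit_def)

lemma length_swap_at [simp]: "length (swap_at i j xs) = length xs"
  by (simp add: swap_at_def)

lemma nth_swap_at: "i < length xs \<Longrightarrow> j < length xs \<Longrightarrow> l < length xs \<Longrightarrow>
    swap_at i j xs ! l = (if l = j then xs ! i else if l = i then xs ! j else xs ! l)"
  by (simp add: swap_at_def nth_list_update)

lemma alternating_swap_at:
  "alternating c \<Longrightarrow> i < length xs \<Longrightarrow> j < length xs \<Longrightarrow> i \<noteq> j \<Longrightarrow> c (swap_at i j xs) = - c xs"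
  by (simp add: alternating_def swap_at_def)

text \<open>Conjugating the swap of \<open>i\<close> and \<open>j\<close> by the adjacent swap of
  \<open>j\<close> and \<open>Suc j\<close> gives the swap of \<open>i\<close> and
  \<open>Suc j\<close>. Each induction step thus adds two sign changes and keeps the total sign
  negative.\<close>

lemma alternatingI_adjacent:
  assumes adj: "\<And>xs p. Suc p < length xs \<Longrightarrow> c (swap_at p (Suc p) xs) = - c xs"
  shows "alternating c"
proof -
  have lt: "c (swap_at i (Suc (i + d)) xs) = - c xs" if "Suc (i + d) < length xs" for i d xs
    using that
  proof (induction d arbitrary: xs)
    case 0
    then show ?case using adj by simp
  next
    case (Suc d)
    let ?j = "Suc (i + d)"
    have "swap_at i (Suc ?j) xs = swap_at ?j (Suc ?j) (swap_at i ?j (swap_at ?j (Suc ?j) xs))"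
      using Suc.prems by (intro nth_equalityI) (auto simp: nth_swap_at)
    also have "c \<dots> = - c xs"
      using Suc adj by simp
    finally show ?case by simp
  qed
  have "c (swap_at i j xs) = - c xs" if "i < length xs" "j < length xs" "i < j" for i j xs
    using lt[of i "j - Suc i" xs] that by simp
  moreover have "swap_at i j xs = swap_at j i xs" if "i \<noteq> j" for i j and xs :: "'a list"
    using that by (simp add: swap_at_def list_update_swap)
  ultimately have "c (swap_at i j xs) = - c xs" if "i < length xs" "j < length xs" "i \<noteq> j" for i j xs
    using that by (metis nat_neq_iff)
  then show ?thesis by (simp add: alternating_def swap_at_def)
qed

lemma alternating_move_front:
  assumes "alternating c" "m < length xs"
  shows "c (xs ! m # omit m xs) = (-1) ^ m * c xs"
  using assms(2)
proof (induction m arbitrary: xs)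
  case 0
  then show ?case by (cases xs) (auto simp: omit_def)
next
  case (Suc m)
  \<comment> \<open>One adjacent swap moves the chosen entry a place forward and leaves the list of
    the others unchanged.\<close>
  have "omit (Suc m) xs = omit m (swap_at m (Suc m) xs)"
    using Suc.prems by (intro nth_equalityI) (auto simp: nth_omit nth_swap_at)
  then have "c (xs ! Suc m # omit (Suc m) xs) = (-1) ^ m * c (swap_at m (Suc m) xs)"
    using Suc.IH[of "swap_at m (Suc m) xs"] Suc.prems by (simp add: nth_swap_at)
  then show ?case using alternating_swap_at[OF assms(1), of m xs "Suc m"] Suc.prems by simp
qed

text \<open>Under an adjacent swap the terms that remove one of the two swapped entries trade
  places, and their neighbouring signs differ. Every other term changes sign because
  \<open>P\<close> is alternating; when an earlier entry is removed, the swap moves one position to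
  the left.\<close>

lemma alternating_alternating_sum:
  fixes P :: "'n \<Rightarrow> 'n list \<Rightarrow> real"
  assumes "\<And>j. alternating (P j)"
  shows "alternating (\<lambda>xs. \<Sum>m<length xs. (-1) ^ m * P (xs ! m) (omit m xs))"
proof (rule alternatingI_adjacent)
  fix xs :: "'n list" and p
  assume p: "Suc p < length xs"
  let ?xs' = "swap_at p (Suc p) xs" and ?\<tau> = "Transposition.transpose p (Suc p)"
  define T where "T m = (-1) ^ m * P (xs ! m) (omit m xs)" for m
  have "(-1) ^ m * P (?xs' ! m) (omit m ?xs') = - T (?\<tau> m)" if m: "m < length xs" for m
  proof -
    consider "m = p" | "m = Suc p" | "m < p" | "m > Suc p" by linarith
    then show ?thesis
    proof cases
      case 1
      then have "omit m ?xs' = omit (Suc p) xs"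
        using p by (intro nth_equalityI) (auto simp: nth_omit nth_swap_at less_Suc_eq)
      then show ?thesis using 1 p by (simp add: T_def nth_swap_at)
    next
      case 2
      then have "omit m ?xs' = omit p xs"
        using p by (intro nth_equalityI) (auto simp: nth_omit nth_swap_at less_Suc_eq)
      then show ?thesis using 2 p by (simp add: T_def nth_swap_at)
    next
      case 3
      then have "omit m ?xs' = swap_at (p - 1) p (omit m xs)"
        using p by (intro nth_equalityI) (auto simp: nth_omit nth_swap_at)
      then show ?thesis using 3 p m alternating_swap_at[OF assms, of "p - 1" "omit m xs" p]
        by (simp add: T_def nth_swap_at Transposition.transpose_def)
    next
      case 4
      then have "omit m ?xs' = swap_at p (Suc p) (omit m xs)"
        using p m by (intro nth_equalityI) (auto simp: nth_omit nth_swap_at)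
      then show ?thesis using 4 p m alternating_swap_at[OF assms, of p "omit m xs" "Suc p"]
        by (simp add: T_def nth_swap_at Transposition.transpose_def)
    qed
  qed
  then have "(\<Sum>m<length ?xs'. (-1) ^ m * P (?xs' ! m) (omit m ?xs')) = - (\<Sum>m<length xs. T (?\<tau> m))"
    by (simp add: sum_negf)
  also have "?\<tau> permutes {..<length xs}" using p by (intro permutes_swap_id) auto
  then have "(\<Sum>m<length xs. T (?\<tau> m)) = (\<Sum>m<length xs. T m)"
    using sum.permute[of ?\<tau> "{..<length xs}" T] by (simp add: comp_def)
  finally show "(\<Sum>m<length ?xs'. (-1) ^ m * P (?xs' ! m) (omit m ?xs'))
      = - (\<Sum>m<length xs. (-1) ^ m * P (xs ! m) (omit m xs))"
    by (simp add: T_def)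
qed

text \<open>Each pair of entries is removed in both orders, with the same value of \<open>Q\<close>
  by symmetry and with opposite signs. \<open>\<sigma>\<close> is the sign-reversing involution that
  exchanges the orders.\<close>

lemma double_alternating_sum_zero:
  fixes Q :: "'n \<Rightarrow> 'n \<Rightarrow> 'n list \<Rightarrow> real"
  assumes "\<And>i j ys. Q i j ys = Q j i ys"
  shows "(\<Sum>m<length xs. (-1) ^ m *
    (\<Sum>l<length (omit m xs). (-1) ^ l * Q (xs ! m) (omit m xs ! l) (omit l (omit m xs)))) = 0"
proof -
  let ?n = "length xs"
  define T where "T = (\<lambda>(m, l). (-1) ^ m * ((-1) ^ l * Q (xs ! m) (omit m xs ! l) (omit l (omit m xs))))"
  \<comment> \<open>After removal of entry \<open>m\<close>, position \<open>l\<close> refers to the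
    original entry \<open>l\<close> if \<open>l < m\<close> and to \<open>Suc l\<close> otherwise;
    this shift by one is the source of the opposite sign.\<close>
  define \<sigma> where "\<sigma> = (\<lambda>(m, l). if l < m then (l, m - 1) else (Suc l, m :: nat))"
  let ?S = "{..<?n} \<times> {..<?n - 1}"
  have omit2: "omit l (omit m xs) = omit (m - 1) (omit l xs)" if "l < m" "m < ?n" for l m
    using that by (intro nth_equalityI) (auto simp: nth_omit)
  have lt: "T (\<sigma> (m, l)) = - T (m, l)" if "l < m" "m < ?n" for m l
  proof -
    obtain m' where m': "m = Suc m'" using \<open>l < m\<close> by (cases m) auto
    show ?thesis using that omit2[OF that] assms[of "xs ! l" "xs ! m"]
      by (simp add: T_def \<sigma>_def nth_omit m')
  qed
  have \<sigma>\<sigma>: "\<sigma> (\<sigma> z) = z" and in_S: "z \<in> ?S \<Longrightarrow> \<sigma> z \<in> ?S" for z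
    by (auto simp: \<sigma>_def split: if_splits prod.splits)
  have neg: "T (\<sigma> z) = - T z" if "z \<in> ?S" for z
  proof -
    obtain m l where z: "z = (m, l)" by (cases z)
    show ?thesis
    proof (cases "l < m")
      case True
      then show ?thesis using lt that z by auto
    next
      case False
      then show ?thesis using lt[of m "Suc l"] \<sigma>\<sigma>[of z] that z by (auto simp: \<sigma>_def)
    qed
  qed
  have "sum T ?S = (\<Sum>z\<in>?S. - T z)"
    by (rule sum.reindex_bij_witness[of _ \<sigma> \<sigma>]) (use \<sigma>\<sigma> in_S neg in auto)
  then have "sum T ?S = 0" by (simp add: sum_negf)
  then show ?thesis
    by (simp add: T_def sum_distrib_left sum.cartesian_product[symmetric])
qed

section \<open>The exterior derivative on boundedly supported forms\<close>

lemma ext_d_eq: "x \<in> U \<Longrightarrow> ext_d U \<omega> x xs =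
    (\<Sum>m<length xs. (-1) ^ m * partial (xs ! m) (\<lambda>y. \<omega> y (omit m xs)) x)"
  by (simp add: ext_d_def omit_def)

lemma ext_d_outside: "x \<notin> U \<Longrightarrow> ext_d U \<omega> x xs = 0"
  by (simp add: ext_d_def)

text \<open>The exterior derivative is local, so the domains may differ away from \<open>x\<close>.
  This is how a piece is compared with a union.\<close>

lemma ext_d_cong:
  assumes "open W" "x \<in> W" "x \<in> U \<longleftrightarrow> x \<in> V" "\<And>y ys. y \<in> W \<Longrightarrow> \<omega> y ys = \<eta> y ys"
  shows "ext_d U \<omega> x xs = ext_d V \<eta> x xs"
proof -
  have "partial j (\<lambda>y. \<omega> y ys) x = partial j (\<lambda>y. \<eta> y ys) x" for j ys
    using assms by (intro partial_cong[OF assms(1,2)]) auto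
  then show ?thesis using assms(3) by (simp add: ext_d_def)
qed

lemma bs_formD:
  assumes "bs_form U k \<omega>"
  shows "length xs \<noteq> k \<Longrightarrow> \<omega> x xs = 0" "x \<notin> U \<Longrightarrow> \<omega> x xs = 0"
    "alternating (\<omega> x)" "smooth_on U (\<lambda>x. \<omega> x xs)"
  using assms by (auto simp: bs_form_def)

lemma bs_form_bounded:
  assumes "bs_form U k \<omega>"
  obtains r where "r > 0" "\<And>x xs. x \<notin> ball 0 r \<Longrightarrow> \<omega> x xs = 0"
  using assms unfolding bs_form_def by metis

lemma bs_formI:
  assumes "\<And>x xs. length xs \<noteq> k \<Longrightarrow> \<omega> x xs = 0" "\<And>x xs. x \<notin> U \<Longrightarrow> \<omega> x xs = 0"
    "\<And>x. alternating (\<omega> x)" "\<And>xs. smooth_on U (\<lambda>x. \<omega> x xs)"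
    "\<And>x xs. x \<in> U \<Longrightarrow> x \<notin> ball 0 r \<Longrightarrow> \<omega> x xs = 0"
  shows "bs_form U k \<omega>"
  unfolding bs_form_def
proof (intro conjI allI impI)
  show "\<exists>r>0. \<forall>x\<in>U. x \<notin> ball 0 r \<longrightarrow> (\<forall>xs. \<omega> x xs = 0)"
    using assms(5) by (intro exI[of _ "max r 1"]) (auto simp: not_less)
qed (use assms(1-4) in auto)

lemma bs_form_has_partial:
  assumes "open U" "bs_form U k \<omega>" "x \<in> U"
  shows "has_partial (\<lambda>y. \<omega> y xs) j x (partial j (\<lambda>y. \<omega> y xs) x)"
  using smooth_on_partial(2)[OF assms(1) bs_formD(4)[OF assms(2)] assms(3)] by simp

text \<open>This one combination covers sums, differences and multiples; differences are written
  with the factor -1 below so that it applies.\<close>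

lemma ext_d_axpy:
  assumes "open U" "bs_form U k \<alpha>" "bs_form U k \<beta>"
  shows "ext_d U (\<lambda>x xs. \<alpha> x xs + c * \<beta> x xs) = (\<lambda>x xs. ext_d U \<alpha> x xs + c * ext_d U \<beta> x xs)"
proof (intro ext)
  fix x xs
  show "ext_d U (\<lambda>x xs. \<alpha> x xs + c * \<beta> x xs) x xs = ext_d U \<alpha> x xs + c * ext_d U \<beta> x xs"
  proof (cases "x \<in> U")
    case True
    have "partial j (\<lambda>y. \<alpha> y ys + c * \<beta> y ys) x = partial j (\<lambda>y. \<alpha> y ys) x + c * partial j (\<lambda>y. \<beta> y ys) x" for j ys
      by (intro has_partial_imp_partial DERIV_add DERIV_cmult
          bs_form_has_partial[OF assms(1,2) True] bs_form_has_partial[OF assms(1,3) True])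
    then show ?thesis using True
      by (simp add: ext_d_eq sum.distrib sum_distrib_left algebra_simps)
  qed (simp add: ext_d_outside)
qed

lemma bs_form_axpy:
  assumes "bs_form U k \<alpha>" "bs_form U k \<beta>"
  shows "bs_form U k (\<lambda>x xs. \<alpha> x xs + c * \<beta> x xs)"
proof -
  obtain r s where "\<And>x xs. x \<notin> ball 0 r \<Longrightarrow> \<alpha> x xs = 0" "\<And>x xs. x \<notin> ball 0 s \<Longrightarrow> \<beta> x xs = 0"
    using bs_form_bounded assms by metis
  then show ?thesis
    using bs_formD[OF assms(1)] bs_formD[OF assms(2)]
    by (intro bs_formI[where r = "max r s"] smooth_on_add smooth_on_cmult) (auto simp: alternating_def)
qed

lemma bs_form_zero: "bs_form U k (\<lambda>_ _. 0)"
  by (rule bs_formI) (auto simp: alternating_def smooth_on_const)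

lemma ext_d_zero: "ext_d (U :: (real^'n::finite) set) (\<lambda>_ _. 0) = (\<lambda>_ _. 0)"
proof -
  have "partial j (\<lambda>_. 0) x = 0" for j :: 'n and x :: "real^'n"
    by (rule has_partial_imp_partial) simp
  then show ?thesis by (intro ext) (simp add: ext_d_def)
qed

lemma bs_form_mult:
  assumes "bs_form U k \<omega>" "smooth_on U f"
  shows "bs_form U k (\<lambda>x xs. f x * \<omega> x xs)"
proof -
  obtain r where "\<And>x xs. x \<notin> ball 0 r \<Longrightarrow> \<omega> x xs = 0"
    using bs_form_bounded assms by metis
  then show ?thesis
    using bs_formD[OF assms(1)]
    by (intro bs_formI[where r = r] smooth_on_mult assms(2)) (auto simp: alternating_def)
qed

lemma bs_form_ext_d:
  fixes \<omega> :: "'n::finite form"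
  assumes U: "open U" and \<omega>: "bs_form U k \<omega>"
  shows "bs_form U (Suc k) (ext_d U \<omega>)"
proof -
  obtain r where r: "\<And>x xs. x \<notin> ball 0 r \<Longrightarrow> \<omega> x xs = 0"
    using bs_form_bounded[OF \<omega>] by metis
  show ?thesis
  \<comment> \<open>A derivative is known to vanish only where the form vanishes on a neighbourhood.
    The larger radius puts \<open>x\<close> into the open set \<open>- cball 0 r\<close>.\<close>
  proof (rule bs_formI[where r = "r + 1"])
    fix x and xs :: "'n list" assume xs: "length xs \<noteq> Suc k"
    have "partial j (\<lambda>y. \<omega> y (omit m xs)) x = 0" if "m < length xs" for j m
      using bs_formD(1)[OF \<omega>, of "omit m xs"] that xs
      by (intro has_partial_imp_partial) (auto simp: Suc_diff_Suc)
    then show "ext_d U \<omega> x xs = 0"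
      by (cases "x \<in> U") (simp_all add: ext_d_eq ext_d_outside)
  next
    show "ext_d U \<omega> x xs = 0" if "x \<notin> U" for x xs using that by (rule ext_d_outside)
  next
    fix x
    show "alternating (ext_d U \<omega> x)"
    proof (cases "x \<in> U")
      case True
      have "alternating (\<lambda>ys. partial j (\<lambda>y. \<omega> y ys) x)" for j
        unfolding alternating_def
      proof (intro allI impI)
        fix ys :: "'n list" and a b
        assume ab: "a < length ys \<and> b < length ys \<and> a \<noteq> b"
        have "(\<lambda>y. \<omega> y (ys[a := ys ! b, b := ys ! a])) = (\<lambda>y. - \<omega> y ys)"
          using bs_formD(3)[OF \<omega>] ab by (auto simp: alternating_def)
        then show "partial j (\<lambda>y. \<omega> y (ys[a := ys ! b, b := ys ! a])) x = - partial j (\<lambda>y. \<omega> y ys) x"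
          using DERIV_minus[OF bs_form_has_partial[OF U \<omega> True]] by (simp add: has_partial_imp_partial)
      qed
      from alternating_alternating_sum[where P = "\<lambda>j ys. partial j (\<lambda>y. \<omega> y ys) x", OF this]
      show ?thesis by (simp flip: ext_d_eq[OF True])
    qed (auto simp: ext_d_outside alternating_def)
  next
    fix xs :: "'n list"
    have "smooth_on U (\<lambda>x. \<Sum>m<length xs. (-1) ^ m * partial (xs ! m) (\<lambda>y. \<omega> y (omit m xs)) x)"
      by (intro smooth_on_sum smooth_on_cmult smooth_on_partial(1)[OF U] bs_formD(4)[OF \<omega>])
    then show "smooth_on U (\<lambda>x. ext_d U \<omega> x xs)"
      by (rule smooth_on_cong[OF U, rotated]) (simp add: ext_d_eq)
  next
    fix x :: "real^'n" and xs assume "x \<notin> ball 0 (r + 1)"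
    then have "ext_d U \<omega> x xs = ext_d U (\<lambda>_ _. 0) x xs"
      using r by (intro ext_d_cong[of "- cball 0 r"]) auto
    then show "ext_d U \<omega> x xs = 0" by (simp add: ext_d_zero)
  qed
qed

lemma ext_d_ext_d:
  assumes U: "open U" and \<omega>: "bs_form U k \<omega>"
  shows "ext_d U (ext_d U \<omega>) = (\<lambda>_ _. 0)"
proof (intro ext)
  fix x xs
  show "ext_d U (ext_d U \<omega>) x xs = 0"
  proof (cases "x \<in> U")
    case True
    define Q where "Q i j ys = partial i (partial j (\<lambda>y. \<omega> y ys)) x" for i j ys
    have "partial i (\<lambda>y. ext_d U \<omega> y ys) x
        = (\<Sum>l<length ys. (-1) ^ l * Q i (ys ! l) (omit l ys))" for i ys
    proof -
      have "partial i (\<lambda>y. ext_d U \<omega> y ys) x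
          = partial i (\<lambda>y. \<Sum>l<length ys. (-1) ^ l * partial (ys ! l) (\<lambda>z. \<omega> z (omit l ys)) y) x"
        by (rule partial_cong[OF U True]) (simp add: ext_d_eq)
      also have "\<dots> = (\<Sum>l<length ys. (-1) ^ l * Q i (ys ! l) (omit l ys))"
        unfolding Q_def
        by (intro has_partial_imp_partial DERIV_sum DERIV_cmult smooth_on_partial[OF U] True bs_formD(4)[OF \<omega>])
      finally show ?thesis .
    qed
    moreover have "Q i j ys = Q j i ys" for i j ys
      unfolding Q_def by (rule partial_commute[OF U bs_formD(4)[OF \<omega>] True])
    ultimately show ?thesis
      using double_alternating_sum_zero[of Q xs] True by (simp add: ext_d_eq[of x U "ext_d U \<omega>"])
  qed (simp add: ext_d_outside)
qed

section \<open>Restriction and gluing\<close>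

definition restr :: "(real^'n::finite) set \<Rightarrow> 'n form \<Rightarrow> 'n form" where
  "restr V \<omega> x xs = (if x \<in> V then \<omega> x xs else 0)"

text \<open>The preference for \<open>P\<close> is harmless when \<open>\<alpha>\<close> and
  \<open>\<beta>\<close> agree on the overlap. Outside both sets the value is that of
  \<open>\<beta>\<close>, which is 0 for a form on \<open>Q\<close>.\<close>

definition glue :: "(real^'n::finite) set \<Rightarrow> 'n form \<Rightarrow> 'n form \<Rightarrow> 'n form" where
  "glue P \<alpha> \<beta> x xs = (if x \<in> P then \<alpha> x xs else \<beta> x xs)"

lemma bs_form_restr:
  assumes "open V" "V \<subseteq> U" "bs_form U k \<omega>"
  shows "bs_form V k (restr V \<omega>)"
proof -
  obtain r where "\<And>x xs. x \<notin> ball 0 r \<Longrightarrow> \<omega> x xs = 0"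
    using bs_form_bounded[OF assms(3)] by metis
  moreover have "smooth_on V (\<lambda>x. restr V \<omega> x xs)" for xs
    by (rule smooth_on_cong[OF assms(1) _ smooth_on_subset[OF bs_formD(4)[OF assms(3)] assms(2)]])
      (simp add: restr_def)
  ultimately show ?thesis
    using bs_formD(1,3)[OF assms(3)]
    by (intro bs_formI[where r = r]) (auto simp: restr_def alternating_def)
qed

lemma ext_d_restr:
  assumes "open V" "V \<subseteq> U"
  shows "ext_d V (restr V \<omega>) = restr V (ext_d U \<omega>)"
proof (intro ext)
  fix x xs
  show "ext_d V (restr V \<omega>) x xs = restr V (ext_d U \<omega>) x xs"
  proof (cases "x \<in> V")
    case True
    then have "ext_d V (restr V \<omega>) x xs = ext_d U \<omega> x xs"
      using assms by (intro ext_d_cong[OF assms(1)]) (auto simp: restr_def)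
    then show ?thesis using True by (simp add: restr_def)
  qed (simp add: restr_def ext_d_outside)
qed

lemma
  assumes P: "open P" "bs_form P k \<alpha>" and Q: "open Q" "bs_form Q k \<beta>"
    and eq: "restr (P \<inter> Q) \<alpha> = restr (P \<inter> Q) \<beta>"
  shows bs_form_glue: "bs_form (P \<union> Q) k (glue P \<alpha> \<beta>)"
    and restr_glue: "restr P (glue P \<alpha> \<beta>) = \<alpha>" "restr Q (glue P \<alpha> \<beta>) = \<beta>"
    and ext_d_glue: "ext_d (P \<union> Q) (glue P \<alpha> \<beta>) = glue P (ext_d P \<alpha>) (ext_d Q \<beta>)"
proof -
  have eq: "\<alpha> x xs = \<beta> x xs" if "x \<in> P" "x \<in> Q" for x xs
    using fun_cong[OF fun_cong[OF eq, of x], of xs] that by (simp add: restr_def)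
  obtain r s where rs: "\<And>x xs. x \<notin> ball 0 r \<Longrightarrow> \<alpha> x xs = 0" "\<And>x xs. x \<notin> ball 0 s \<Longrightarrow> \<beta> x xs = 0"
    using bs_form_bounded P(2) Q(2) by metis
  show "bs_form (P \<union> Q) k (glue P \<alpha> \<beta>)"
  proof (rule bs_formI[where r = "max r s"])
    fix xs
    have "smooth_on P (\<lambda>x. glue P \<alpha> \<beta> x xs)"
      by (rule smooth_on_cong[OF P(1) _ bs_formD(4)[OF P(2), of xs]]) (simp add: glue_def)
    moreover have "smooth_on Q (\<lambda>x. glue P \<alpha> \<beta> x xs)"
      by (rule smooth_on_cong[OF Q(1) _ bs_formD(4)[OF Q(2), of xs]]) (simp add: glue_def eq)
    ultimately show "smooth_on (P \<union> Q) (\<lambda>x. glue P \<alpha> \<beta> x xs)"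
      using P(1) Q(1) by (intro smooth_on_locally) blast
  qed (use bs_formD[OF P(2)] bs_formD[OF Q(2)] rs in \<open>auto simp: glue_def alternating_def\<close>)
  show "restr P (glue P \<alpha> \<beta>) = \<alpha>" "restr Q (glue P \<alpha> \<beta>) = \<beta>"
    using bs_formD(2)[OF P(2)] bs_formD(2)[OF Q(2)] eq by (auto simp: restr_def glue_def fun_eq_iff)
  show "ext_d (P \<union> Q) (glue P \<alpha> \<beta>) = glue P (ext_d P \<alpha>) (ext_d Q \<beta>)"
  proof (intro ext)
    fix x xs
    consider "x \<in> P" | "x \<in> Q" "x \<notin> P" | "x \<notin> P \<union> Q" by blast
    then show "ext_d (P \<union> Q) (glue P \<alpha> \<beta>) x xs = glue P (ext_d P \<alpha>) (ext_d Q \<beta>) x xs"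
    proof cases
      case 1
      then have "ext_d (P \<union> Q) (glue P \<alpha> \<beta>) x xs = ext_d P \<alpha> x xs"
        by (intro ext_d_cong[OF P(1)]) (auto simp: glue_def)
      then show ?thesis using 1 by (simp add: glue_def)
    next
      case 2
      then have "ext_d (P \<union> Q) (glue P \<alpha> \<beta>) x xs = ext_d Q \<beta> x xs"
        by (intro ext_d_cong[OF Q(1)]) (auto simp: glue_def eq)
      then show ?thesis using 2 by (simp add: glue_def)
    next
      case 3
      then show ?thesis by (simp add: glue_def ext_d_outside)
    qed
  qed
qed

section \<open>Homotopy operators\<close>

text \<open>For the affine homotopy \<open>F\<^sub>t x = (1 + c t) x + t w\<close>, whose velocity at \<open>t\<close> is the
  \<open>t\<close>-independent field \<open>X x = c x + w\<close>, this is
  \<open>x \<mapsto> \<integral>\<^sub>0\<^sup>T (1 + c t)\<^sup>k (\<iota>\<^sub>X \<omega>) (F\<^sub>t x) dt\<close> for a \<open>(k + 1)\<close>-form \<open>\<omega>\<close>. With \<open>c = 0\<close> the flow is a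
  translation, with \<open>c = -1\<close> it contracts to the point \<open>w\<close> at time \<open>1\<close>.\<close>

definition homotopy_op :: "(real^'n::finite) set \<Rightarrow> real \<Rightarrow> real^'n \<Rightarrow> real \<Rightarrow> nat \<Rightarrow> 'n form \<Rightarrow> 'n form" where
  "homotopy_op U c w T k \<omega> x xs = (if x \<in> U then
     (\<Sum>j\<in>UNIV. (c * x $ j + w $ j) *
        integral {0..T} (\<lambda>t. (1 + c * t) ^ k * \<omega> ((1 + c * t) *\<^sub>R x + t *\<^sub>R w) (j # xs))) else 0)"

lemma smooth_on_affine_coord: "smooth_on U (\<lambda>x. c * x $ j + d)"
  by (intro smooth_on_add smooth_on_cmult smooth_on_const smooth_on_linear) (simp add: linear_iff)

text \<open>For fixed \<open>x\<close> the path is the straight line through \<open>x\<close> with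
  velocity \<open>c *\<^sub>R x + w\<close>, so this is a directional derivative moved to time
  \<open>t\<close>.\<close>

lemma has_real_derivative_along_flow:
  fixes g :: "real^'n::finite \<Rightarrow> real"
  assumes "open U" "smooth_on U g" "(1 + c * t) *\<^sub>R x + t *\<^sub>R w \<in> U"
  shows "((\<lambda>t. g ((1 + c * t) *\<^sub>R x + t *\<^sub>R w)) has_real_derivative
    (\<Sum>j\<in>UNIV. (c * x $ j + w $ j) * partial j g ((1 + c * t) *\<^sub>R x + t *\<^sub>R w))) (at t)"
proof -
  have F: "x + t *\<^sub>R (c *\<^sub>R x + w) = (1 + c * t) *\<^sub>R x + t *\<^sub>R w" for t
    by (simp add: algebra_simps)
  have "((\<lambda>s. g ((x + t *\<^sub>R (c *\<^sub>R x + w)) + s *\<^sub>R (c *\<^sub>R x + w))) has_real_derivative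
      (\<Sum>j\<in>UNIV. (c *\<^sub>R x + w) $ j * partial j g (x + t *\<^sub>R (c *\<^sub>R x + w)))) (at 0)"
    by (rule smooth_on_directional_derivative[OF assms(1,2)]) (simp only: F assms(3))
  from has_derivative_along_shift[OF this] show ?thesis by (simp only: F) simp
qed

text \<open>\<open>supp\<close> says that no point outside one fixed ball is carried into the
  support of \<open>\<omega>\<close> at any time in the interval. It is what bounds the support of
  the integral.\<close>

lemma bs_form_homotopy_op:
  assumes U: "open U" and F: "\<And>x t. x \<in> U \<Longrightarrow> t \<in> {0..T} \<Longrightarrow> (1 + c * t) *\<^sub>R x + t *\<^sub>R w \<in> U"
    and \<omega>: "bs_form U (Suc k) \<omega>"
    and supp: "\<And>x t xs. x \<in> U \<Longrightarrow> x \<notin> ball 0 r \<Longrightarrow> t \<in> {0..T} \<Longrightarrow> \<omega> ((1 + c * t) *\<^sub>R x + t *\<^sub>R w) xs = 0"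
  shows "bs_form U k (homotopy_op U c w T k \<omega>)"
proof (rule bs_formI[where r = r])
  show "homotopy_op U c w T k \<omega> x xs = 0" if "length xs \<noteq> k" for x xs
    using bs_formD(1)[OF \<omega>, of "_ # xs"] that by (simp add: homotopy_op_def)
  show "homotopy_op U c w T k \<omega> x xs = 0" if "x \<notin> U" for x xs
    using that by (simp add: homotopy_op_def)
  show "homotopy_op U c w T k \<omega> x xs = 0" if "x \<in> U" "x \<notin> ball 0 r" for x xs
  proof -
    have "integral {0..T} (\<lambda>t. (1 + c * t) ^ k * \<omega> ((1 + c * t) *\<^sub>R x + t *\<^sub>R w) (j # xs)) = integral {0..T} (\<lambda>_. 0)" for j
      using supp[OF that] by (intro integral_cong) simp
    then show ?thesis by (simp add: homotopy_op_def)
  qed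
  show "alternating (homotopy_op U c w T k \<omega> x)" for x
    unfolding alternating_def
  proof (intro allI impI)
    fix xs :: "'a list" and a b
    assume ab: "a < length xs \<and> b < length xs \<and> a \<noteq> b"
    have "\<omega> y (j # xs[a := xs ! b, b := xs ! a]) = - \<omega> y (j # xs)" for y j
      using alternating_swap_at[OF bs_formD(3)[OF \<omega>], of "Suc a" "j # xs" "Suc b" y] ab
      by (simp add: swap_at_def)
    then show "homotopy_op U c w T k \<omega> x (xs[a := xs ! b, b := xs ! a]) = - homotopy_op U c w T k \<omega> x xs"
      by (simp add: homotopy_op_def sum_negf)
  qed
  fix xs
  have "smooth_on U (\<lambda>x. \<Sum>j\<in>UNIV. (c * x $ j + w $ j) *
        integral {0..T} (\<lambda>t. (1 + c * t) ^ k * \<omega> ((1 + c * t) *\<^sub>R x + t *\<^sub>R w) (j # xs)))"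
    by (intro smooth_on_sum smooth_on_mult smooth_on_affine_coord
        smooth_on_integral_flow[OF U F _ bs_formD(4)[OF \<omega>]] continuous_intros)
  then show "smooth_on U (\<lambda>x. homotopy_op U c w T k \<omega> x xs)"
    by (rule smooth_on_cong[OF U, rotated]) (simp add: homotopy_op_def)
qed

text \<open>In the expansion of \<open>d\<omega>\<close> at \<open>j # xs\<close>, the term that
  removes \<open>j\<close> is taken to the other side; all remaining positions are shifted by one,
  which flips their signs.\<close>

lemma closed_form_cocycle:
  fixes \<omega> :: "'n::finite form"
  assumes "ext_d U \<omega> = (\<lambda>_ _. 0)" "y \<in> U"
  shows "(\<Sum>m<length xs. (-1) ^ m * partial (xs ! m) (\<lambda>y. \<omega> y (j # omit m xs)) y)
    = partial j (\<lambda>y. \<omega> y xs) y"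
proof -
  have "ext_d U \<omega> y (j # xs) = 0" using assms(1) by simp
  then show ?thesis
    using assms(2) by (simp add: ext_d_eq sum.lessThan_Suc_shift omit_Cons sum_negf del: sum.lessThan_Suc)
qed

text \<open>Cartan's formula integrated over time. The differential of the flow map is
  multiplication by \<open>1 + c * t\<close>, so the pullback of a \<open>Suc k\<close>-form carries
  that factor to the power \<open>Suc k\<close>. Closedness removes the contraction of
  \<open>d\<omega>\<close>, and what remains is the time derivative of the pullback.\<close>

lemma ext_d_homotopy_op:
  fixes \<omega> :: "'n::finite form"
  assumes U: "open U" and T: "0 \<le> T"
    and F: "\<And>x t. x \<in> U \<Longrightarrow> t \<in> {0..T} \<Longrightarrow> (1 + c * t) *\<^sub>R x + t *\<^sub>R w \<in> U"
    and \<omega>: "bs_form U (Suc k) \<omega>" and closed: "ext_d U \<omega> = (\<lambda>_ _. 0)"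
    and x: "x \<in> U" and xs: "length xs = Suc k"
  shows "ext_d U (homotopy_op U c w T k \<omega>) x xs =
    (1 + c * T) ^ Suc k * \<omega> ((1 + c * T) *\<^sub>R x + T *\<^sub>R w) xs - \<omega> x xs"
proof -
  let ?F = "\<lambda>t x. (1 + c * t) *\<^sub>R x + t *\<^sub>R w" and ?X = "\<lambda>x j. c * x $ j + w $ j"
  define I where "I y j ys = integral {0..T} (\<lambda>t. (1 + c * t) ^ k * \<omega> (?F t y) (j # ys))" for y j ys
  define J where "J i j ys = integral {0..T} (\<lambda>t. ((1 + c * t) ^ k * (1 + c * t)) * partial i (\<lambda>y. \<omega> y (j # ys)) (?F t x))"
    for i j ys
  have sm: "smooth_on U (\<lambda>y. \<omega> y ys)" for ys by (rule bs_formD(4)[OF \<omega>])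
  have int: "(\<lambda>t. q t * h (?F t x)) integrable_on {0..T}"
    if "continuous_on {0..T} q" "smooth_on U h" for q and h :: "real^'n \<Rightarrow> real"
    by (intro integrable_continuous_real continuous_on_mult that(1) continuous_intros
        continuous_on_compose2[OF smooth_on_imp_continuous_on[OF that(2)]])
      (use F[OF x] in auto)
  have pw: "continuous_on {0..T} (\<lambda>t. (1 + c * t) ^ n)" for n by (intro continuous_intros)
  \<comment> \<open>The term with \<open>c\<close> comes from differentiating the coefficient
    \<open>c * x $ j + w $ j\<close>, whose partial derivative is nonzero only in direction
    \<open>j\<close>. \<open>J\<close> has one more factor \<open>1 + c * t\<close>, from the chain
    rule.\<close>
  have partial_op: "partial i (\<lambda>y. homotopy_op U c w T k \<omega> y ys) x
      = c * I x i ys + (\<Sum>j\<in>UNIV. ?X x j * J i j ys)" for i ys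
  proof -
    have "has_partial (\<lambda>y. ?X y j) i x (if i = j then c else 0)" for j
      by (auto simp: axis_def intro!: derivative_eq_intros)
    moreover have "has_partial (\<lambda>y. I y j ys) i x (J i j ys)" for j
      unfolding I_def J_def by (rule has_partial_integral_flow[OF U F pw sm x])
    ultimately have "has_partial (\<lambda>y. ?X y j * I y j ys) i x
        ((if i = j then c else 0) * I x j ys + J i j ys * ?X x j)" for j
      using DERIV_mult[of "\<lambda>t. ?X (x + t *\<^sub>R axis i 1) j" _ 0 UNIV "\<lambda>t. I (x + t *\<^sub>R axis i 1) j ys"] by simp
    then have "has_partial (\<lambda>y. \<Sum>j\<in>UNIV. ?X y j * I y j ys) i x
        (\<Sum>j\<in>UNIV. (if i = j then c else 0) * I x j ys + J i j ys * ?X x j)"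
      by (intro DERIV_sum)
    moreover have "partial i (\<lambda>y. homotopy_op U c w T k \<omega> y ys) x = partial i (\<lambda>y. \<Sum>j\<in>UNIV. ?X y j * I y j ys) x"
      by (rule partial_cong[OF U x]) (simp add: homotopy_op_def I_def)
    ultimately show ?thesis
      by (simp add: has_partial_imp_partial sum.distrib if_distrib[of "\<lambda>z. z * _"] mult.commute[of _ "_ + _"] cong: if_cong)
  qed
  have front: "(-1) ^ m * I x (xs ! m) (omit m xs) = integral {0..T} (\<lambda>t. (1 + c * t) ^ k * \<omega> (?F t x) xs)"
    if "m < length xs" for m
  proof -
    have "(\<lambda>t. (1 + c * t) ^ k * \<omega> (?F t x) (xs ! m # omit m xs)) =
      (\<lambda>t. (-1) ^ m * ((1 + c * t) ^ k * \<omega> (?F t x) xs))"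
      using alternating_move_front[OF bs_formD(3)[OF \<omega>] that] by (simp add: mult_ac)
    then have "I x (xs ! m) (omit m xs) = (-1) ^ m * integral {0..T} (\<lambda>t. (1 + c * t) ^ k * \<omega> (?F t x) xs)"
      unfolding I_def by (simp only: integral_mult_right)
    then show ?thesis by (simp add: mult.assoc[symmetric] flip: power_mult_distrib)
  qed
  have cocycle: "(\<Sum>m<length xs. (-1) ^ m * J (xs ! m) j (omit m xs))
      = integral {0..T} (\<lambda>t. (1 + c * t) ^ Suc k * partial j (\<lambda>y. \<omega> y xs) (?F t x))" for j
  proof -
    have "(\<Sum>m<length xs. (-1) ^ m * J (xs ! m) j (omit m xs)) =
        (\<Sum>m<length xs. integral {0..T} (\<lambda>t. (-1) ^ m * ((1 + c * t) ^ Suc k * partial (xs ! m) (\<lambda>y. \<omega> y (j # omit m xs)) (?F t x))))"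
      by (simp add: J_def mult_ac)
    also have "\<dots> = integral {0..T} (\<lambda>t. \<Sum>m<length xs. (-1) ^ m * ((1 + c * t) ^ Suc k * partial (xs ! m) (\<lambda>y. \<omega> y (j # omit m xs)) (?F t x)))"
      by (intro integral_sum[symmetric] integrable_on_mult_right int pw smooth_on_partial(1)[OF U] sm) simp
    also have "\<dots> = integral {0..T} (\<lambda>t. (1 + c * t) ^ Suc k * partial j (\<lambda>y. \<omega> y xs) (?F t x))"
    proof (rule integral_cong)
      fix t assume "t \<in> {0..T}"
      from closed_form_cocycle[OF closed F[OF x this], of xs j]
      show "(\<Sum>m<length xs. (-1) ^ m * ((1 + c * t) ^ Suc k * partial (xs ! m) (\<lambda>y. \<omega> y (j # omit m xs)) (?F t x)))
        = (1 + c * t) ^ Suc k * partial j (\<lambda>y. \<omega> y xs) (?F t x)"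
        by (simp add: sum_distrib_left[symmetric] mult.left_commute[of "(-1) ^ _"])
    qed
    finally show ?thesis .
  qed
  let ?A = "\<lambda>t. (1 + c * t) ^ k * \<omega> (?F t x) xs"
  let ?B = "\<lambda>j t. (1 + c * t) ^ Suc k * partial j (\<lambda>y. \<omega> y xs) (?F t x)"
  have intB: "?B j integrable_on {0..T}" for j by (intro int pw smooth_on_partial(1)[OF U] sm)
  have "ext_d U (homotopy_op U c w T k \<omega>) x xs =
      (\<Sum>m<length xs. c * ((-1) ^ m * I x (xs ! m) (omit m xs)))
      + (\<Sum>m<length xs. \<Sum>j\<in>UNIV. ?X x j * ((-1) ^ m * J (xs ! m) j (omit m xs)))"
    by (simp add: ext_d_eq[OF x] partial_op sum.distrib sum_distrib_left algebra_simps)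
  \<comment> \<open>Moving each entry to the front makes all \<open>Suc k\<close> positions
    contribute the same integral; this factor matches the derivative of the power
    \<open>Suc k\<close>.\<close>
  also have "(\<Sum>m<length xs. c * ((-1) ^ m * I x (xs ! m) (omit m xs))) = Suc k * (c * integral {0..T} ?A)"
    using front xs by simp
  also have "(\<Sum>m<length xs. \<Sum>j\<in>UNIV. ?X x j * ((-1) ^ m * J (xs ! m) j (omit m xs)))
      = (\<Sum>j\<in>UNIV. ?X x j * integral {0..T} (?B j))"
    by (subst sum.swap) (simp only: sum_distrib_left[symmetric] cocycle)
  also have "Suc k * (c * integral {0..T} ?A) + (\<Sum>j\<in>UNIV. ?X x j * integral {0..T} (?B j)) =
      integral {0..T} (\<lambda>t. Suc k * (c * ?A t) + (\<Sum>j\<in>UNIV. ?X x j * ?B j t))"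
  proof -
    have "(\<lambda>t. Suc k * (c * ?A t)) integrable_on {0..T}"
      by (intro integrable_on_mult_right int pw sm)
    moreover have "(\<lambda>t. \<Sum>j\<in>UNIV. ?X x j * ?B j t) integrable_on {0..T}"
      by (intro integrable_sum integrable_on_mult_right intB) simp
    moreover have "integral {0..T} (\<lambda>t. \<Sum>j\<in>UNIV. ?X x j * ?B j t) = (\<Sum>j\<in>UNIV. ?X x j * integral {0..T} (?B j))"
    proof -
      have "integral {0..T} (\<lambda>t. \<Sum>j\<in>UNIV. ?X x j * ?B j t) = (\<Sum>j\<in>UNIV. integral {0..T} (\<lambda>t. ?X x j * ?B j t))"
        by (intro integral_sum integrable_on_mult_right intB) simp
      then show ?thesis by (simp only: integral_mult_right)
    qed
    ultimately show ?thesis by (simp only: integral_add integral_mult_right)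
  qed
  also have "\<dots> = (1 + c * T) ^ Suc k * \<omega> (?F T x) xs - (1 + c * 0) ^ Suc k * \<omega> (?F 0 x) xs"
  proof (intro integral_unique fundamental_theorem_of_calculus T)
    fix t assume t: "t \<in> {0..T}"
    have "((\<lambda>t. (1 + c * t) ^ Suc k) has_real_derivative Suc k * (c * (1 + c * t) ^ k)) (at t)"
      by (auto intro!: derivative_eq_intros simp del: power_Suc)
    from DERIV_mult[OF this has_real_derivative_along_flow[OF U sm F[OF x t]], of xs]
    have "((\<lambda>t. (1 + c * t) ^ Suc k * \<omega> (?F t x) xs) has_real_derivative
        Suc k * (c * ?A t) + (\<Sum>j\<in>UNIV. ?X x j * ?B j t)) (at t)"
      by (rule DERIV_cong) (simp add: sum_distrib_right sum_distrib_left mult_ac)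
    then show "((\<lambda>t. (1 + c * t) ^ Suc k * \<omega> (?F t x) xs) has_vector_derivative
        Suc k * (c * ?A t) + (\<Sum>j\<in>UNIV. ?X x j * ?B j t)) (at t within {0..T})"
      by (simp add: has_real_derivative_iff_has_vector_derivative has_vector_derivative_at_within)
  qed
  finally show ?thesis by simp
qed

text \<open>Degree 0 has no primitives. Here closedness means that all partial derivatives vanish,
  hence also the derivative along every flow line.\<close>

lemma closed_0_form_flow_invariant:
  fixes \<omega> :: "'n::finite form"
  assumes U: "open U" and T: "0 \<le> T"
    and F: "\<And>x t. x \<in> U \<Longrightarrow> t \<in> {0..T} \<Longrightarrow> (1 + c * t) *\<^sub>R x + t *\<^sub>R w \<in> U"
    and \<omega>: "bs_form U 0 \<omega>" and closed: "ext_d U \<omega> = (\<lambda>_ _. 0)" and x: "x \<in> U"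
  shows "\<omega> ((1 + c * T) *\<^sub>R x + T *\<^sub>R w) [] = \<omega> x []"
proof -
  let ?g = "\<lambda>t. \<omega> ((1 + c * t) *\<^sub>R x + t *\<^sub>R w) []"
  have "(?g has_real_derivative 0) (at t within {0..T})" if "t \<in> {0..T}" for t
  proof -
    have "partial j (\<lambda>y. \<omega> y []) ((1 + c * t) *\<^sub>R x + t *\<^sub>R w) = 0" for j
      using closed_form_cocycle[OF closed F[OF x that], of "[]" j] by simp
    then show ?thesis
      using has_real_derivative_along_flow[OF U bs_formD(4)[OF \<omega>] F[OF x that], of "[]"]
      by (simp add: has_field_derivative_at_within)
  qed
  then obtain a where "\<And>t. t \<in> {0..T} \<Longrightarrow> ?g t = a"
    using has_field_derivative_zero_constant[of "{0..T}" ?g] by auto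
  from this[of 0] this[of T] show ?thesis using T by simp
qed

lemma exact_bs_if_uminus:
  assumes "open U" "bs_form U k \<eta>" "\<And>x xs. ext_d U \<eta> x xs = - \<omega> x xs"
  shows "exact_bs U (Suc k) \<omega>"
proof -
  have "ext_d U (\<lambda>x xs. 0 + (-1) * \<eta> x xs) = \<omega>"
    using assms(3) ext_d_axpy[OF assms(1) bs_form_zero assms(2), of "-1"] by (simp add: ext_d_zero)
  with bs_form_axpy[OF bs_form_zero assms(2), of "-1"] show ?thesis
    unfolding exact_bs_def by auto
qed

lemma Hbs_zero_if_translation_escapes:
  fixes U :: "(real^'n::finite) set"
  assumes U: "open U" and F: "\<And>x t. x \<in> U \<Longrightarrow> 0 \<le> t \<Longrightarrow> x + t *\<^sub>R v \<in> U"
    and escape: "\<And>r. \<exists>T. \<forall>x\<in>U. \<forall>t\<ge>T. x + t *\<^sub>R v \<notin> ball 0 r"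
  shows "Hbs_zero U k"
  unfolding Hbs_zero_def
proof (intro allI impI)
  fix \<omega> assume "closed_bs U k \<omega>"
  then have \<omega>: "bs_form U k \<omega>" and closed: "ext_d U \<omega> = (\<lambda>_ _. 0)" by (auto simp: closed_bs_def)
  obtain r where r: "r > 0" "\<And>x xs. x \<notin> ball 0 r \<Longrightarrow> \<omega> x xs = 0"
    using bs_form_bounded[OF \<omega>] by metis
  obtain T0 where T0: "\<forall>x\<in>U. \<forall>t\<ge>T0. x + t *\<^sub>R v \<notin> ball 0 r" using escape by blast
  define T where "T = max T0 0"
  have T: "0 \<le> T" by (simp add: T_def)
  have end0: "\<omega> (x + T *\<^sub>R v) xs = 0" if "x \<in> U" for x xs
    using T0 that r(2) by (simp add: T_def)
  have F': "(1 + 0 * t) *\<^sub>R x + t *\<^sub>R v \<in> U" if "x \<in> U" "t \<in> {0..T}" for x t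
    using F that by simp
  show "exact_bs U k \<omega>"
  proof (cases k)
    case 0
    have "\<omega> x xs = 0" for x xs
      using closed_0_form_flow_invariant[OF U T F' _ closed, where x = x] \<omega> end0[of x "[]"]
        bs_formD(1)[OF \<omega>, of xs x] bs_formD(2)[OF \<omega>, of x xs] by (cases xs; cases "x \<in> U") (auto simp: 0)
    then show ?thesis by (auto simp: exact_bs_def 0)
  next
    case (Suc k')
    have \<omega>: "bs_form U (Suc k') \<omega>" using \<omega> Suc by simp
    have "bs_form U k' (homotopy_op U 0 v T k' \<omega>)"
    \<comment> \<open>Within time \<open>T\<close> a point travels at most
      \<open>T * norm v\<close>, so from outside this radius it cannot reach the ball of radius
      \<open>r\<close> that carries \<open>\<omega>\<close>.\<close>
    proof (rule bs_form_homotopy_op[OF U F' \<omega>, where r = "r + T * norm v"])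
      fix x :: "real^'n" and t xs assume x: "x \<notin> ball 0 (r + T * norm v)" and t: "t \<in> {0..T}"
      have "norm x \<le> norm (x + t *\<^sub>R v) + norm (t *\<^sub>R v)"
        using norm_triangle_ineq4[of "x + t *\<^sub>R v" "t *\<^sub>R v"] by simp
      moreover have "norm (t *\<^sub>R v) \<le> T * norm v" using t by (simp add: mult_right_mono)
      ultimately show "\<omega> ((1 + 0 * t) *\<^sub>R x + t *\<^sub>R v) xs = 0"
        using x by (intro r(2)) simp
    qed
    moreover have "ext_d U (homotopy_op U 0 v T k' \<omega>) x xs = - \<omega> x xs" for x xs
    proof (cases "x \<in> U \<and> length xs = Suc k'")
      case True
      then show ?thesis
        using ext_d_homotopy_op[OF U T F' \<omega> closed, where x = x and xs = xs] end0[of x xs] by simp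
    next
      case False
      then show ?thesis
        using bs_formD(1,2)[OF \<omega>] bs_formD(1,2)[OF bs_form_ext_d[OF U calculation]] by auto
    qed
    ultimately show ?thesis unfolding Suc by (rule exact_bs_if_uminus[OF U])
  qed
qed

text \<open>For the contraction the scaling factor is 0 at time 1, so in positive degree the end
  term disappears. In degree 0 the value at the end point \<open>p\<close> survives and a closed
  function is constant. Constants are boundedly supported because \<open>U\<close> is
  bounded.\<close>

lemma Hbs_bounded_convex:
  fixes U :: "(real^'n::finite) set"
  assumes U: "open U" "convex U" "bounded U" "U \<noteq> {}"
  shows "Hbs_iso_R U 0" "Hbs_zero U (Suc k)"
proof -
  obtain p where p: "p \<in> U" using U(4) by blast
  have F: "(1 + (-1) * t) *\<^sub>R x + t *\<^sub>R p \<in> U" if "x \<in> U" "t \<in> {0..1}" for x t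
    using convexD[OF U(2) that(1) p, of "1 - t" t] that by simp
  show "Hbs_zero U (Suc k)"
    unfolding Hbs_zero_def
  proof (intro allI impI)
    fix \<omega> assume "closed_bs U (Suc k) \<omega>"
    then have \<omega>: "bs_form U (Suc k) \<omega>" and closed: "ext_d U \<omega> = (\<lambda>_ _. 0)" by (auto simp: closed_bs_def)
    obtain r where "U \<subseteq> ball 0 r" using bounded_subset_ballD[OF U(3)] by blast
    then have "bs_form U k (homotopy_op U (-1) p 1 k \<omega>)"
      by (intro bs_form_homotopy_op[OF U(1) F \<omega>, where r = r]) auto
    moreover have "ext_d U (homotopy_op U (-1) p 1 k \<omega>) x xs = - \<omega> x xs" for x xs
    proof (cases "x \<in> U \<and> length xs = Suc k")
      case True
      then show ?thesis
        using ext_d_homotopy_op[OF U(1) _ F \<omega> closed, where x = x and xs = xs] by simp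
    next
      case False
      then show ?thesis
        using bs_formD(1,2)[OF \<omega>] bs_formD(1,2)[OF bs_form_ext_d[OF U(1) calculation]] by auto
    qed
    ultimately show "exact_bs U (Suc k) \<omega>" by (rule exact_bs_if_uminus[OF U(1)])
  qed
  define \<omega> :: "'n form" where "\<omega> x xs = (if x \<in> U \<and> xs = [] then 1 else 0)" for x xs
  obtain r where r: "U \<subseteq> ball 0 r" using bounded_subset_ballD[OF U(3)] by blast
  have "smooth_on U (\<lambda>x. \<omega> x xs)" for xs
    by (rule smooth_on_cong[OF U(1) _ smooth_on_const[of U "if xs = [] then 1 else 0"]]) (simp add: \<omega>_def)
  then have \<omega>: "bs_form U 0 \<omega>"
    by (intro bs_formI[where r = r]) (use r in \<open>auto simp: \<omega>_def alternating_def\<close>)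
  have "ext_d U \<omega> x xs = 0" for x xs
  proof (cases "x \<in> U")
    case True
    have "ext_d U \<omega> x xs = ext_d U (\<lambda>_ ys. if ys = [] then 1 else 0) x xs"
      by (rule ext_d_cong[OF U(1) True]) (simp_all add: \<omega>_def)
    moreover have "partial j (\<lambda>_. a) x = 0" for j a
      by (rule has_partial_imp_partial) simp
    ultimately show ?thesis by (simp add: ext_d_def)
  qed (simp add: ext_d_outside)
  then have "closed_bs U 0 \<omega>" using \<omega> by (auto simp: closed_bs_def)
  moreover have "\<not> exact_bs U 0 \<omega>"
  proof
    assume "exact_bs U 0 \<omega>"
    then have "\<omega> p [] = 0" by (simp add: exact_bs_def)
    then show False using p by (simp add: \<omega>_def)
  qed
  moreover have "\<exists>c. exact_bs U 0 (\<lambda>x xs. \<theta> x xs - c * \<omega> x xs)" if "closed_bs U 0 \<theta>" for \<theta>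
  proof -
    have \<theta>: "bs_form U 0 \<theta>" "ext_d U \<theta> = (\<lambda>_ _. 0)" using that by (auto simp: closed_bs_def)
    have "\<theta> x [] = \<theta> p []" if "x \<in> U" for x
      using closed_0_form_flow_invariant[where T = 1, OF U(1) _ F \<theta> that] by simp
    then have "\<theta> x xs - \<theta> p [] * \<omega> x xs = 0" for x xs
      using bs_formD(1)[OF \<theta>(1), of xs x] bs_formD(2)[OF \<theta>(1), of x xs] by (cases "x \<in> U"; cases xs) (auto simp: \<omega>_def)
    then have "(\<lambda>x xs. \<theta> x xs - \<theta> p [] * \<omega> x xs) = (\<lambda>_ _. 0)" by (intro ext)
    then show ?thesis unfolding exact_bs_def by (metis (full_types))
  qed
  ultimately show "Hbs_iso_R U 0" unfolding Hbs_iso_R_def by blast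
qed

section \<open>Mayer--Vietoris\<close>

lemma restr_axpy:
  "restr V (\<lambda>x xs. \<alpha> x xs + c * \<beta> x xs) = (\<lambda>x xs. restr V \<alpha> x xs + c * restr V \<beta> x xs)"
  by (intro ext) (simp add: restr_def)

lemma restr_zero: "restr V (\<lambda>_ _. 0) = (\<lambda>_ _. 0)"
  by (intro ext) (simp add: restr_def)

lemma restr_restr: "V \<subseteq> W \<Longrightarrow> restr V (restr W \<omega>) = restr V \<omega>"
  by (intro ext) (auto simp: restr_def)

lemma glue_restr: "bs_form (P \<union> Q) k \<theta> \<Longrightarrow> glue P (restr P \<theta>) (restr Q \<theta>) = \<theta>"
  by (intro ext) (auto simp: restr_def glue_def bs_formD(2))

lemma closed_bs_restr:
  assumes "open V" "V \<subseteq> U" "closed_bs U k \<omega>"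
  shows "closed_bs V k (restr V \<omega>)"
  using assms bs_form_restr[OF assms(1,2)] ext_d_restr[OF assms(1,2), of \<omega>]
  by (simp add: closed_bs_def restr_zero)

text \<open>\<open>split\<close> is surjectivity of the difference map from pairs of forms to forms
  on the overlap, the part of the short exact sequence that needs a cut-off; exactness elsewhere is
  gluing. Acyclicity of \<open>P\<close> and \<open>Q\<close> in all degrees makes the connecting
  map an isomorphism.\<close>

locale mayer_vietoris =
  fixes P Q :: "(real^'n::finite) set"
  assumes open_P: "open P" and open_Q: "open Q"
    and zero_P: "Hbs_zero P k" and zero_Q: "Hbs_zero Q k"
    and split: "bs_form (P \<inter> Q) k \<delta> \<Longrightarrow> \<exists>A B. bs_form P k A \<and> bs_form Q k B \<and>
      \<delta> = (\<lambda>x xs. restr (P \<inter> Q) A x xs + (-1) * restr (P \<inter> Q) B x xs)"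
begin

abbreviation "diff_restr A B \<equiv> (\<lambda>x xs. restr (P \<inter> Q) A x xs + (-1) * restr (P \<inter> Q) B x xs)"

lemma open_Int: "open (P \<inter> Q)" using open_P open_Q by auto

lemma bs_form_restr_Int:
  "bs_form P k A \<Longrightarrow> bs_form (P \<inter> Q) k (restr (P \<inter> Q) A)"
  "bs_form Q k B \<Longrightarrow> bs_form (P \<inter> Q) k (restr (P \<inter> Q) B)"
  by (auto intro: bs_form_restr[OF open_Int])

lemma ext_d_diff_restr:
  assumes "bs_form P k A" "bs_form Q k B"
  shows "ext_d (P \<inter> Q) (diff_restr A B) = diff_restr (ext_d P A) (ext_d Q B)"
  using ext_d_axpy[OF open_Int bs_form_restr_Int(1)[OF assms(1)] bs_form_restr_Int(2)[OF assms(2)], of "-1"]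
  by (simp only: ext_d_restr[OF open_Int Int_lower1, of A] ext_d_restr[OF open_Int Int_lower2, of B])

text \<open>A splitting of \<open>\<delta>\<close> itself need not consist of closed forms, so a
  primitive of \<open>\<delta>\<close> is split instead and the two parts are
  differentiated.\<close>

lemma exact_Int_imp_closed_pair:
  assumes "exact_bs (P \<inter> Q) k \<delta>"
  shows "\<exists>A B. closed_bs P k A \<and> closed_bs Q k B \<and> \<delta> = diff_restr A B"
proof (cases k)
  case 0
  have "closed_bs P k (\<lambda>_ _. 0)" "closed_bs Q k (\<lambda>_ _. 0)"
    by (simp_all add: closed_bs_def bs_form_zero ext_d_zero)
  moreover have "\<delta> = diff_restr (\<lambda>_ _. 0) (\<lambda>_ _. 0)" using assms 0 by (simp add: exact_bs_def restr_zero)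
  ultimately show ?thesis by blast
next
  case (Suc k')
  then obtain \<gamma> where \<gamma>: "bs_form (P \<inter> Q) k' \<gamma>" "ext_d (P \<inter> Q) \<gamma> = \<delta>"
    using assms by (auto simp: exact_bs_def)
  obtain A B where AB: "bs_form P k' A" "bs_form Q k' B" "\<gamma> = diff_restr A B"
    using split[OF \<gamma>(1)] by blast
  have "closed_bs P k (ext_d P A)" "closed_bs Q k (ext_d Q B)"
    using AB(1,2) by (simp_all add: closed_bs_def Suc bs_form_ext_d ext_d_ext_d open_P open_Q)
  moreover have "\<delta> = diff_restr (ext_d P A) (ext_d Q B)"
    using \<gamma>(2) AB(3) ext_d_diff_restr[OF AB(1,2)] by simp
  ultimately show ?thesis by blast
qed

text \<open>Converse of the preceding lemma: primitives on the acyclic pieces are restricted and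
  subtracted. Together they identify the exact forms on the overlap with the differences of closed
  pairs.\<close>

lemma closed_pair_imp_exact_Int:
  assumes "closed_bs P k A" "closed_bs Q k B"
  shows "exact_bs (P \<inter> Q) k (diff_restr A B)"
proof -
  have ex: "exact_bs P k A" "exact_bs Q k B"
    using zero_P zero_Q assms by (auto simp: Hbs_zero_def)
  show ?thesis
  proof (cases k)
    case 0
    then show ?thesis using ex by (simp add: exact_bs_def restr_zero)
  next
    case (Suc k')
    then obtain A' B' where AB: "bs_form P k' A'" "ext_d P A' = A" "bs_form Q k' B'" "ext_d Q B' = B"
      using ex by (auto simp: exact_bs_def)
    have "bs_form (P \<inter> Q) k' (diff_restr A' B')"
      by (rule bs_form_axpy[OF bs_form_restr_Int(1)[OF AB(1)] bs_form_restr_Int(2)[OF AB(3)]])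
    then show ?thesis
      using ext_d_diff_restr[OF AB(1,3)] AB(2,4) by (auto simp: exact_bs_def Suc)
  qed
qed

text \<open>This inverts the connecting map: two local primitives of the same global form differ on
  the overlap by a closed form one degree lower.\<close>

lemma primitives:
  assumes "closed_bs (P \<union> Q) (Suc k) \<theta>"
  shows "\<exists>\<alpha> \<beta>. bs_form P k \<alpha> \<and> bs_form Q k \<beta> \<and> ext_d P \<alpha> = restr P \<theta> \<and> ext_d Q \<beta> = restr Q \<theta> \<and>
    closed_bs (P \<inter> Q) k (diff_restr \<alpha> \<beta>)"
proof -
  have "exact_bs P (Suc k) (restr P \<theta>)" "exact_bs Q (Suc k) (restr Q \<theta>)"
    using zero_P zero_Q closed_bs_restr[OF open_P _ assms] closed_bs_restr[OF open_Q _ assms]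
    by (auto simp: Hbs_zero_def)
  then obtain \<alpha> \<beta> where *: "bs_form P k \<alpha>" "bs_form Q k \<beta>"
    "ext_d P \<alpha> = restr P \<theta>" "ext_d Q \<beta> = restr Q \<theta>"
    by (auto simp: exact_bs_def)
  have "ext_d (P \<inter> Q) (diff_restr \<alpha> \<beta>) = (\<lambda>_ _. 0)"
    using ext_d_diff_restr[OF *(1,2)] *(3,4) by (simp add: restr_restr)
  moreover have "bs_form (P \<inter> Q) k (diff_restr \<alpha> \<beta>)"
    by (rule bs_form_axpy[OF bs_form_restr_Int(1)[OF *(1)] bs_form_restr_Int(2)[OF *(2)]])
  ultimately show ?thesis using * by (auto simp: closed_bs_def)
qed

lemma exact_UnI:
  assumes "bs_form P k \<alpha>" "bs_form Q k \<beta>" "restr (P \<inter> Q) \<alpha> = restr (P \<inter> Q) \<beta>"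
    and "bs_form (P \<union> Q) (Suc k) \<theta>" "ext_d P \<alpha> = restr P \<theta>" "ext_d Q \<beta> = restr Q \<theta>"
  shows "exact_bs (P \<union> Q) (Suc k) \<theta>"
  using bs_form_glue[OF open_P assms(1) open_Q assms(2,3)] ext_d_glue[OF open_P assms(1) open_Q assms(2,3)]
    glue_restr[OF assms(4)] assms(5,6)
  by (auto simp: exact_bs_def)

lemma Hbs_zero_Un_0: "Hbs_zero (P \<union> Q) 0"
  unfolding Hbs_zero_def
proof (intro allI impI)
  fix \<theta> assume \<theta>: "closed_bs (P \<union> Q) 0 \<theta>"
  have "restr P \<theta> = (\<lambda>_ _. 0)" "restr Q \<theta> = (\<lambda>_ _. 0)"
    using zero_P[of 0] zero_Q[of 0] closed_bs_restr[OF open_P _ \<theta>] closed_bs_restr[OF open_Q _ \<theta>]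
    by (auto simp: Hbs_zero_def exact_bs_def)
  with glue_restr[of P Q 0 \<theta>] \<theta> show "exact_bs (P \<union> Q) 0 \<theta>"
    by (auto simp: closed_bs_def exact_bs_def glue_def fun_eq_iff)
qed

text \<open>The connecting isomorphism sends the class of \<open>A - B\<close> on \<open>P \<inter> Q\<close> to the class of the form that is
  \<open>dA\<close> on \<open>P\<close> and \<open>dB\<close> on \<open>Q\<close>.\<close>

lemma Hbs_zero_Un_Suc:
  assumes "Hbs_zero (P \<inter> Q) k"
  shows "Hbs_zero (P \<union> Q) (Suc k)"
  unfolding Hbs_zero_def
proof (intro allI impI)
  fix \<theta> assume \<theta>: "closed_bs (P \<union> Q) (Suc k) \<theta>"
  obtain \<alpha> \<beta> where \<alpha>\<beta>: "bs_form P k \<alpha>" "bs_form Q k \<beta>" "ext_d P \<alpha> = restr P \<theta>" "ext_d Q \<beta> = restr Q \<theta>"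
    "closed_bs (P \<inter> Q) k (diff_restr \<alpha> \<beta>)"
    using primitives[OF \<theta>] by blast
  obtain A B where AB: "closed_bs P k A" "closed_bs Q k B" "diff_restr \<alpha> \<beta> = diff_restr A B"
    using exact_Int_imp_closed_pair assms \<alpha>\<beta>(5) unfolding Hbs_zero_def by blast
  \<comment> \<open>Subtracting the closed forms \<open>A\<close> and \<open>B\<close> leaves the
    derivatives alone and makes the two primitives agree on the overlap, so that they can be
    glued.\<close>
  let ?\<alpha> = "\<lambda>x xs. \<alpha> x xs + (-1) * A x xs" and ?\<beta> = "\<lambda>x xs. \<beta> x xs + (-1) * B x xs"
  have AB': "bs_form P k A" "bs_form Q k B" "ext_d P A = (\<lambda>_ _. 0)" "ext_d Q B = (\<lambda>_ _. 0)"
    using AB(1,2) by (auto simp: closed_bs_def)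
  have "restr (P \<inter> Q) ?\<alpha> = restr (P \<inter> Q) ?\<beta>"
    unfolding restr_axpy using AB(3) by (auto simp: fun_eq_iff algebra_simps)
  moreover have "ext_d P ?\<alpha> = restr P \<theta>" "ext_d Q ?\<beta> = restr Q \<theta>"
    using ext_d_axpy[OF open_P \<alpha>\<beta>(1) AB'(1), of "-1"] ext_d_axpy[OF open_Q \<alpha>\<beta>(2) AB'(2), of "-1"]
      AB'(3,4) \<alpha>\<beta>(3,4) by simp_all
  ultimately show "exact_bs (P \<union> Q) (Suc k) \<theta>"
    using \<theta> by (intro exact_UnI[of k ?\<alpha> ?\<beta>] bs_form_axpy \<alpha>\<beta> AB') (auto simp: closed_bs_def)
qed

lemma Hbs_iso_R_Un_Suc:
  assumes "Hbs_iso_R (P \<inter> Q) k"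
  shows "Hbs_iso_R (P \<union> Q) (Suc k)"
proof -
  obtain \<omega>0 where \<omega>0: "closed_bs (P \<inter> Q) k \<omega>0" "\<not> exact_bs (P \<inter> Q) k \<omega>0"
    "\<And>\<theta>. closed_bs (P \<inter> Q) k \<theta> \<Longrightarrow> \<exists>c. exact_bs (P \<inter> Q) k (\<lambda>x xs. \<theta> x xs - c * \<omega>0 x xs)"
    using assms unfolding Hbs_iso_R_def by blast
  obtain A0 B0 where A0: "bs_form P k A0" and B0: "bs_form Q k B0" and \<omega>0_eq: "\<omega>0 = diff_restr A0 B0"
    using split[of k \<omega>0] \<omega>0(1) unfolding closed_bs_def by blast
  have dA0: "bs_form P (Suc k) (ext_d P A0)" "ext_d P (ext_d P A0) = (\<lambda>_ _. 0)"
    and dB0: "bs_form Q (Suc k) (ext_d Q B0)" "ext_d Q (ext_d Q B0) = (\<lambda>_ _. 0)"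
    using A0 B0 by (simp_all add: bs_form_ext_d ext_d_ext_d open_P open_Q)
  have "diff_restr (ext_d P A0) (ext_d Q B0) = (\<lambda>_ _. 0)"
    using \<omega>0(1) ext_d_diff_restr[OF A0 B0] by (simp add: closed_bs_def \<omega>0_eq)
  then have eq: "restr (P \<inter> Q) (ext_d P A0) = restr (P \<inter> Q) (ext_d Q B0)"
    by (auto simp: fun_eq_iff)
  define \<omega>1 where "\<omega>1 = glue P (ext_d P A0) (ext_d Q B0)"
  have \<omega>1: "bs_form (P \<union> Q) (Suc k) \<omega>1"
    and restr_\<omega>1: "restr P \<omega>1 = ext_d P A0" "restr Q \<omega>1 = ext_d Q B0"
    and "ext_d (P \<union> Q) \<omega>1 = glue P (\<lambda>_ _. 0) (\<lambda>_ _. 0)"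
    unfolding \<omega>1_def
    using bs_form_glue[OF open_P dA0(1) open_Q dB0(1) eq] restr_glue[OF open_P dA0(1) open_Q dB0(1) eq]
      ext_d_glue[OF open_P dA0(1) open_Q dB0(1) eq] dA0(2) dB0(2) by simp_all
  then have closed: "closed_bs (P \<union> Q) (Suc k) \<omega>1"
    by (simp add: closed_bs_def glue_def fun_eq_iff)
  have not_exact: "\<not> exact_bs (P \<union> Q) (Suc k) \<omega>1"
  proof
    assume "exact_bs (P \<union> Q) (Suc k) \<omega>1"
    then obtain \<eta> where \<eta>: "bs_form (P \<union> Q) k \<eta>" "ext_d (P \<union> Q) \<eta> = \<omega>1"
      by (auto simp: exact_bs_def)
    \<comment> \<open>If \<open>\<omega>1\<close> is \<open>d\<eta>\<close>, subtracting
      \<open>\<eta>\<close> turns \<open>A0\<close> and \<open>B0\<close> into closed forms with the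
      same difference \<open>\<omega>0\<close>, which would make \<open>\<omega>0\<close>
      exact.\<close>
    let ?A = "\<lambda>x xs. A0 x xs + (-1) * restr P \<eta> x xs" and ?B = "\<lambda>x xs. B0 x xs + (-1) * restr Q \<eta> x xs"
    have rP: "bs_form P k (restr P \<eta>)" "ext_d P (restr P \<eta>) = ext_d P A0"
      and rQ: "bs_form Q k (restr Q \<eta>)" "ext_d Q (restr Q \<eta>) = ext_d Q B0"
      using \<eta> restr_\<omega>1 by (simp_all add: bs_form_restr[OF open_P Un_upper1] bs_form_restr[OF open_Q Un_upper2]
          ext_d_restr[OF open_P Un_upper1[of P Q], of \<eta>] ext_d_restr[OF open_Q Un_upper2[of Q P], of \<eta>])
    have "closed_bs P k ?A" "closed_bs Q k ?B"
      using ext_d_axpy[OF open_P A0 rP(1), of "-1"] ext_d_axpy[OF open_Q B0 rQ(1), of "-1"] rP(2) rQ(2)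
        bs_form_axpy[OF A0 rP(1), of "-1"] bs_form_axpy[OF B0 rQ(1), of "-1"]
      by (simp_all add: closed_bs_def)
    from closed_pair_imp_exact_Int[OF this]
    have "exact_bs (P \<inter> Q) k (diff_restr ?A ?B)" .
    moreover have "diff_restr ?A ?B = \<omega>0"
      unfolding restr_axpy \<omega>0_eq by (auto simp: restr_def fun_eq_iff)
    ultimately show False using \<omega>0(2) by simp
  qed
  have "\<exists>c. exact_bs (P \<union> Q) (Suc k) (\<lambda>x xs. \<theta> x xs - c * \<omega>1 x xs)" if \<theta>: "closed_bs (P \<union> Q) (Suc k) \<theta>" for \<theta>
  proof -
    obtain \<alpha> \<beta> where \<alpha>\<beta>: "bs_form P k \<alpha>" "bs_form Q k \<beta>" "ext_d P \<alpha> = restr P \<theta>" "ext_d Q \<beta> = restr Q \<theta>"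
      "closed_bs (P \<inter> Q) k (diff_restr \<alpha> \<beta>)"
      using primitives[OF \<theta>] by blast
    obtain c where "exact_bs (P \<inter> Q) k (\<lambda>x xs. diff_restr \<alpha> \<beta> x xs - c * \<omega>0 x xs)"
      using \<omega>0(3)[OF \<alpha>\<beta>(5)] by blast
    then obtain A B where AB: "closed_bs P k A" "closed_bs Q k B"
      "(\<lambda>x xs. diff_restr \<alpha> \<beta> x xs - c * \<omega>0 x xs) = diff_restr A B"
      using exact_Int_imp_closed_pair by blast
    have AB': "bs_form P k A" "bs_form Q k B" "ext_d P A = (\<lambda>_ _. 0)" "ext_d Q B = (\<lambda>_ _. 0)"
      using AB(1,2) by (auto simp: closed_bs_def)
    \<comment> \<open>The primitives of \<open>\<theta>\<close> are corrected twice: by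
      \<open>c\<close> times \<open>A0\<close> and \<open>B0\<close> to absorb the class of
      \<open>\<omega>0\<close>, and by the closed pair to absorb the exact remainder.\<close>
    let ?\<alpha> = "\<lambda>x xs. (\<alpha> x xs + (-c) * A0 x xs) + (-1) * A x xs"
    let ?\<beta> = "\<lambda>x xs. (\<beta> x xs + (-c) * B0 x xs) + (-1) * B x xs"
    let ?\<theta> = "\<lambda>x xs. \<theta> x xs + (-c) * \<omega>1 x xs"
    have bs: "bs_form P k (\<lambda>x xs. \<alpha> x xs + (-c) * A0 x xs)" "bs_form Q k (\<lambda>x xs. \<beta> x xs + (-c) * B0 x xs)"
      by (intro bs_form_axpy \<alpha>\<beta> A0 B0)+
    have "restr (P \<inter> Q) ?\<alpha> = restr (P \<inter> Q) ?\<beta>"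
    proof (intro ext)
      fix x xs
      show "restr (P \<inter> Q) ?\<alpha> x xs = restr (P \<inter> Q) ?\<beta> x xs"
        using fun_cong[OF fun_cong[OF AB(3), of x], of xs]
        by (auto simp: restr_axpy \<omega>0_eq restr_def algebra_simps split: if_splits)
    qed
    moreover have "ext_d P ?\<alpha> = restr P ?\<theta>"
      by (simp only: ext_d_axpy[OF open_P bs(1) AB'(1)] ext_d_axpy[OF open_P \<alpha>\<beta>(1) A0] AB'(3) \<alpha>\<beta>(3)
          restr_axpy restr_\<omega>1) simp
    moreover have "ext_d Q ?\<beta> = restr Q ?\<theta>"
      by (simp only: ext_d_axpy[OF open_Q bs(2) AB'(2)] ext_d_axpy[OF open_Q \<alpha>\<beta>(2) B0] AB'(4) \<alpha>\<beta>(4)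
          restr_axpy restr_\<omega>1) simp
    moreover have "bs_form (P \<union> Q) (Suc k) ?\<theta>"
      using \<theta> \<omega>1 by (intro bs_form_axpy) (auto simp: closed_bs_def)
    ultimately have "exact_bs (P \<union> Q) (Suc k) ?\<theta>"
      by (intro exact_UnI[of k ?\<alpha> ?\<beta>] bs_form_axpy[OF bs(1) AB'(1)] bs_form_axpy[OF bs(2) AB'(2)])
    then show ?thesis by (intro exI[of _ c]) simp
  qed
  with closed not_exact show ?thesis unfolding Hbs_iso_R_def by blast
qed

end

section \<open>Convex sets\<close>

lemma bs_form_extend_by_zero:
  assumes "open W" "open V" "W \<subseteq> P" "P \<subseteq> W \<union> V" "bs_form W k \<omega>" "\<And>x xs. x \<in> V \<Longrightarrow> \<omega> x xs = 0"
  shows "bs_form P k \<omega>"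
proof -
  obtain r where r: "\<And>x xs. x \<notin> ball 0 r \<Longrightarrow> \<omega> x xs = 0"
    using bs_form_bounded[OF assms(5)] by metis
  show ?thesis
  proof (rule bs_formI[where r = r])
    fix xs
    have "smooth_on V (\<lambda>x. \<omega> x xs)"
      by (rule smooth_on_cong[OF assms(2) _ smooth_on_const[of V 0]]) (simp add: assms(6))
    then show "smooth_on P (\<lambda>x. \<omega> x xs)"
      using bs_formD(4)[OF assms(5), of xs] assms(1,2,4) by (intro smooth_on_locally) blast
    show "\<omega> x xs = 0" if "x \<notin> P" for x
      using bs_formD(2)[OF assms(5)] assms(3) that by blast
  qed (use bs_formD(1,3)[OF assms(5)] r in auto)
qed

text \<open>\<open>U\<close> is invariant in both directions along \<open>w\<close>; the cut bounds
  \<open>w \<bullet> x\<close> from below, so forward translation pushes this inner product to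
  infinity uniformly.\<close>

lemma Hbs_zero_half:
  fixes U :: "(real^'n::finite) set"
  assumes U: "open U" "\<And>x t. x \<in> U \<Longrightarrow> x + t *\<^sub>R w \<in> U" and w: "w \<noteq> 0"
  shows "Hbs_zero {x\<in>U. w \<bullet> x > -1} k"
proof (rule Hbs_zero_if_translation_escapes[where v = w])
  have "{x\<in>U. w \<bullet> x > -1} = U \<inter> {x. w \<bullet> x > -1}" by auto
  then show "open {x\<in>U. w \<bullet> x > -1}" using U(1) open_halfspace_gt[of "-1" w] by (simp add: open_Int)
  show "x + t *\<^sub>R w \<in> {x \<in> U. -1 < w \<bullet> x}" if "x \<in> {x \<in> U. -1 < w \<bullet> x}" "0 \<le> t" for x t
  proof -
    have "0 \<le> t * (w \<bullet> w)" using that(2) by simp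
    moreover have "x \<in> U" "-1 < w \<bullet> x" using that(1) by auto
    ultimately have "-1 < w \<bullet> (x + t *\<^sub>R w)" unfolding inner_add_right inner_scaleR_right by linarith
    then show ?thesis using U(2) \<open>x \<in> U\<close> by blast
  qed
  fix r
  have ww: "w \<bullet> w > 0" using w by simp
  \<comment> \<open>This time is chosen so that \<open>w \<bullet> (x + t *\<^sub>R w)\<close>
    exceeds \<open>norm w * r\<close>, which Cauchy--Schwarz forbids inside the ball.\<close>
  have "x + t *\<^sub>R w \<notin> ball 0 r" if "w \<bullet> x > -1" "t \<ge> (norm w * r + 1) / (w \<bullet> w)" for x t
  proof
    assume "x + t *\<^sub>R w \<in> ball 0 r"
    then have "norm w * norm (x + t *\<^sub>R w) \<le> norm w * r" by (intro mult_left_mono) auto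
    then have "w \<bullet> (x + t *\<^sub>R w) \<le> norm w * r" using norm_cauchy_schwarz order_trans by blast
    moreover have "t * (w \<bullet> w) \<ge> norm w * r + 1" using that(2) ww by (simp add: field_simps)
    ultimately show False using that(1) by (simp add: inner_add_right)
  qed
  then show "\<exists>T. \<forall>x\<in>{x \<in> U. -1 < w \<bullet> x}. \<forall>t\<ge>T. x + t *\<^sub>R w \<notin> ball 0 r" by blast
qed

text \<open>Stated for a subspace \<open>S\<close> that preserves \<open>U\<close> instead of
  \<open>stab U\<close>, so that the induction step need not compute the stabiliser of the
  slab.\<close>

lemma Hbs_bounded_mod_subspace:
  fixes U S B :: "(real^'n::finite) set"
  assumes "open U" "convex U" "U \<noteq> {}" "subspace S" "\<And>x s. x \<in> U \<Longrightarrow> s \<in> S \<Longrightarrow> x + s \<in> U"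
    and "bounded B" "U \<subseteq> {b + s | b s. b \<in> B \<and> s \<in> S}"
  shows "Hbs_iso_R U (dim S) \<and> (\<forall>k. k \<noteq> dim S \<longrightarrow> Hbs_zero U k)"
  using assms
proof (induction "dim S" arbitrary: U S B)
  case 0
  then have "S \<subseteq> {0}" using dim_eq_0 by metis
  then have "U \<subseteq> B" using 0(8) by fastforce
  then have "bounded U" using 0(7) bounded_subset by blast
  note Hbs = Hbs_bounded_convex[OF 0(2,3) this 0(4)]
  then show ?case using 0(1) by (metis not0_implies_Suc)
next
  case (Suc n)
  note U = Suc.prems(1-3) and S = Suc.prems(4) and inv = Suc.prems(5)
  have "\<not> S \<subseteq> {0}" using Suc(2) dim_eq_0[of S] by linarith
  then obtain v where v: "v \<in> S" "v \<noteq> 0" by auto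
  then have vv: "v \<bullet> v > 0" by simp
  have flow: "x + t *\<^sub>R v \<in> U" if "x \<in> U" for x t
    using inv[OF that] v(1) S by (simp add: subspace_mul)
  define P Q where "P = {x\<in>U. v \<bullet> x > -1}" and "Q = {x\<in>U. v \<bullet> x < 1}"
  have Int_eq: "P \<inter> Q = U \<inter> {x. v \<bullet> x > -1} \<inter> {x. v \<bullet> x < 1}" and Un_eq: "P \<union> Q = U"
    by (auto simp: P_def Q_def)
  have Q_eq: "Q = {x\<in>U. (- v) \<bullet> x > -1}" by (auto simp: Q_def)
  have open_PQ: "open P" "open Q"
    using open_Int[OF U(1) open_halfspace_gt[of "-1" v]] open_Int[OF U(1) open_halfspace_lt[of v 1]]
    by (simp_all add: P_def Q_def Int_def)
  obtain \<psi> :: "real \<Rightarrow> real" where \<psi>: "\<And>U (v :: real^'n). smooth_on U (\<lambda>x. \<psi> (v \<bullet> x))"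
    "\<And>t. t \<le> - 1/2 \<Longrightarrow> \<psi> t = 1" "\<And>t. t \<ge> 1/2 \<Longrightarrow> \<psi> t = 0"
    using smooth_step by blast
  interpret mayer_vietoris P Q
  proof
    show "open P" "open Q" by (fact open_PQ)+
    show "Hbs_zero P k" for k unfolding P_def by (rule Hbs_zero_half[OF U(1) flow v(2)])
    show "Hbs_zero Q k" for k unfolding Q_eq
      using flow[of _ "- _"] v(2) by (intro Hbs_zero_half[OF U(1)]) auto
    fix k and \<delta> :: "'n form" assume \<delta>: "bs_form (P \<inter> Q) k \<delta>"
    \<comment> \<open>The two factors differ by 1. \<open>?A\<close> vanishes for
      \<open>v \<bullet> x\<close> above 1/2 and so extends by zero from the slab to
      \<open>P\<close>; \<open>?B\<close> vanishes below -1/2 and extends to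
      \<open>Q\<close>.\<close>
    let ?A = "\<lambda>x xs. \<psi> (v \<bullet> x) * \<delta> x xs" and ?B = "\<lambda>x xs. (\<psi> (v \<bullet> x) - 1) * \<delta> x xs"
    have "bs_form P k ?A"
    proof (rule bs_form_extend_by_zero[of "P \<inter> Q" "{x. v \<bullet> x > 1/2}"])
      show "bs_form (P \<inter> Q) k ?A" by (rule bs_form_mult[OF \<delta> \<psi>(1)])
      show "open {x. v \<bullet> x > 1/2}" by (rule open_halfspace_gt)
    qed (use \<psi>(3) open_PQ in \<open>auto simp: P_def Q_def\<close>)
    moreover have "bs_form Q k ?B"
    proof (rule bs_form_extend_by_zero[of "P \<inter> Q" "{x. v \<bullet> x < -1/2}"])
      show "bs_form (P \<inter> Q) k ?B" by (intro bs_form_mult[OF \<delta>] smooth_on_diff \<psi>(1) smooth_on_const)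
      show "open {x. v \<bullet> x < -1/2}" by (rule open_halfspace_lt)
    qed (use \<psi>(2) open_PQ in \<open>auto simp: P_def Q_def\<close>)
    moreover have "\<delta> = (\<lambda>x xs. restr (P \<inter> Q) ?A x xs + (-1) * restr (P \<inter> Q) ?B x xs)"
      using bs_formD(2)[OF \<delta>] by (auto simp: fun_eq_iff restr_def algebra_simps)
    ultimately show "\<exists>A B. bs_form P k A \<and> bs_form Q k B \<and>
        \<delta> = (\<lambda>x xs. restr (P \<inter> Q) A x xs + (-1) * restr (P \<inter> Q) B x xs)" by blast
  qed
  define S' where "S' = {y \<in> S. \<forall>x \<in> span {v}. orthogonal x y}"
  have S'_iff: "y \<in> S' \<longleftrightarrow> y \<in> S \<and> v \<bullet> y = 0" for y
    by (auto simp: S'_def orthogonal_def span_singleton intro: exI[of _ "1::real"])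
  have "dim S' + dim (span {v}) = dim S"
    unfolding S'_def using v(1) S by (intro dim_subspace_orthogonal_to_vectors) (auto simp: span_minimal)
  then have dim_S': "n = dim S'" using Suc(2) v(2) by (simp add: dim_insert)
  obtain M where M: "\<And>b. b \<in> B \<Longrightarrow> norm b \<le> M" using Suc.prems(6) bounded_iff by metis
  have "Hbs_iso_R (P \<inter> Q) (dim S') \<and> (\<forall>k. k \<noteq> dim S' \<longrightarrow> Hbs_zero (P \<inter> Q) k)"
  proof (rule Suc.hyps(1)[OF dim_S'])
    show "open (P \<inter> Q)" by (rule open_Int)
    show "convex (P \<inter> Q)"
      unfolding Int_eq by (intro convex_Int U(2) convex_halfspace_gt convex_halfspace_lt)
    obtain x where x: "x \<in> U" using U(3) by blast
    let ?y = "x + (- (v \<bullet> x) / (v \<bullet> v)) *\<^sub>R v"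
    have "v \<bullet> ?y = 0" using v(2) by (simp add: inner_diff_right)
    then have "?y \<in> P \<inter> Q"
      using flow[OF x, of "- (v \<bullet> x) / (v \<bullet> v)"] unfolding P_def Q_def by simp
    then show "P \<inter> Q \<noteq> {}" by blast
    show "subspace S'"
      using S by (auto simp: subspace_def S'_iff inner_add_right)
    show "x + s \<in> P \<inter> Q" if "x \<in> P \<inter> Q" "s \<in> S'" for x s
      using that inv by (auto simp: P_def Q_def S'_iff inner_add_right)
    \<comment> \<open>The component of \<open>s\<close> along \<open>v\<close> is moved over to
      \<open>b\<close>. In the slab \<open>\<bar>v \<bullet> x\<bar> \<le> 1\<close>, and
      \<open>\<bar>v \<bullet> b\<bar> \<le> norm v * M\<close>, so that component has norm at most
      \<open>(1 + norm v * M) / norm v\<close>.\<close>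
    show "bounded (cball (0::real^'n) (M + (1 + norm v * M) / norm v))" by simp
    show "P \<inter> Q \<subseteq> {b + s | b s. b \<in> cball 0 (M + (1 + norm v * M) / norm v) \<and> s \<in> S'}"
    proof
      fix x assume x: "x \<in> P \<inter> Q"
      then obtain b s where bs: "x = b + s" "b \<in> B" "s \<in> S"
        using Suc.prems(7) by (auto simp: P_def)
      define a where "a = (v \<bullet> s) / (v \<bullet> v)"
      have "v \<bullet> (s - a *\<^sub>R v) = 0" using vv by (simp add: a_def inner_diff_right)
      then have s': "s - a *\<^sub>R v \<in> S'" using bs(3) v(1) S by (simp add: S'_iff subspace_diff subspace_mul)
      have "\<bar>v \<bullet> b\<bar> \<le> norm v * M"
        using Cauchy_Schwarz_ineq2[of v b] M[OF bs(2)] by (meson mult_left_mono norm_ge_zero order_trans)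
      moreover have "\<bar>v \<bullet> x\<bar> \<le> 1" using x by (auto simp: P_def Q_def)
      moreover have "v \<bullet> s = v \<bullet> x - v \<bullet> b" by (simp add: bs(1) inner_add_right)
      ultimately have "\<bar>v \<bullet> s\<bar> \<le> 1 + norm v * M" by linarith
      moreover have "norm (a *\<^sub>R v) = \<bar>v \<bullet> s\<bar> / norm v"
        using v(2) by (simp add: a_def dot_square_norm power2_eq_square)
      ultimately have "norm (a *\<^sub>R v) \<le> (1 + norm v * M) / norm v"
        using v(2) by (simp add: divide_right_mono)
      then have "norm (b + a *\<^sub>R v) \<le> M + (1 + norm v * M) / norm v"
        using M[OF bs(2)] norm_triangle_ineq[of b "a *\<^sub>R v"] by linarith
      moreover have "x = (b + a *\<^sub>R v) + (s - a *\<^sub>R v)" by (simp add: bs(1))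
      ultimately show "x \<in> {b + s | b s. b \<in> cball 0 (M + (1 + norm v * M) / norm v) \<and> s \<in> S'}"
        using s' by (simp only: mem_Collect_eq mem_cball_0) blast
    qed
  qed
  then have "Hbs_iso_R U (Suc n)" "\<And>k. k \<noteq> n \<Longrightarrow> Hbs_zero U (Suc k)" "Hbs_zero U 0"
    using Hbs_iso_R_Un_Suc Hbs_zero_Un_Suc Hbs_zero_Un_0 unfolding Un_eq dim_S'[symmetric] by blast+
  then show ?case unfolding Suc(2)[symmetric] by (metis not0_implies_Suc)
qed

section \<open>Recession directions and the stabiliser\<close>

lemma recession_from_closure:
  fixes U :: "'a::euclidean_space set"
  assumes "convex U" "open U" "b \<in> closure U" "\<And>t. t \<ge> 0 \<Longrightarrow> b + t *\<^sub>R v \<in> closure U"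
    and "x \<in> U" "t \<ge> 0"
  shows "x + t *\<^sub>R v \<in> U"
proof -
  have in_closure: "x + t *\<^sub>R v \<in> closure U" if "x \<in> U" for x
  proof -
    \<comment> \<open>Segments from \<open>x\<close> to ever more distant points of the ray through
      \<open>b\<close> turn parallel to \<open>v\<close>: with weight \<open>1 / Suc n\<close> on
      the point at time \<open>Suc n * t\<close>, the influence of \<open>b\<close> dies out and
      \<open>t *\<^sub>R v\<close> remains.\<close>
    let ?y = "\<lambda>n. (1 - inverse (real (Suc n))) *\<^sub>R x + inverse (real (Suc n)) *\<^sub>R (b + (real (Suc n) * t) *\<^sub>R v)"
    have "?y n \<in> closure U" for n
      using that assms(4)[of "real (Suc n) * t"] assms(6) closure_subset[of U]
      by (intro convexD[OF convex_closure[OF assms(1)]]) (auto simp: field_simps simp del: of_nat_Suc)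
    moreover have "?y = (\<lambda>n. (1 - inverse (real (Suc n))) *\<^sub>R x + inverse (real (Suc n)) *\<^sub>R b + t *\<^sub>R v)"
      by (intro ext) (simp add: algebra_simps del: of_nat_Suc)
    moreover have "(\<lambda>n. (1 - inverse (real (Suc n))) *\<^sub>R x + inverse (real (Suc n)) *\<^sub>R b + t *\<^sub>R v)
        \<longlonglongrightarrow> (1 - 0) *\<^sub>R x + 0 *\<^sub>R b + t *\<^sub>R v"
      by (intro tendsto_intros LIMSEQ_inverse_real_of_nat)
    ultimately show ?thesis
      using closed_sequentially[OF closed_closure[of U], of ?y "x + t *\<^sub>R v"] by simp
  qed
  have "(\<lambda>x. t *\<^sub>R v + x) ` U \<subseteq> closure U" using in_closure by (auto simp: add.commute)
  \<comment> \<open>The whole translate of \<open>U\<close> is open, so lying in the closure it lies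
    in its interior, which is \<open>U\<close> itself by convexity.\<close>
  then have "(\<lambda>x. t *\<^sub>R v + x) ` U \<subseteq> interior (closure U)"
    by (rule interior_maximal) (rule open_translation[OF assms(2)])
  also have "interior (closure U) = U"
    using convex_interior_closure[OF assms(1)] assms(2) by (simp add: interior_open)
  finally show ?thesis using assms(5) by (auto simp: add.commute)
qed

text \<open>Without a uniform time, points translated by ever larger \<open>t n\<close> stay in the
  ball and accumulate at some \<open>l\<close>. As \<open>t n\<close> eventually exceeds any fixed
  \<open>s\<close>, going back by \<open>s\<close> does not leave \<open>U\<close>, so
  \<open>l\<close> starts a ray in direction \<open>- v\<close> in the closure; that direction then
  preserves all of \<open>U\<close>, against the choice of \<open>x0\<close>.\<close>

lemma escape_if_not_reverse_recession:
  fixes U :: "'a::euclidean_space set"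
  assumes U: "convex U" "open U" and rec: "\<And>x t. x \<in> U \<Longrightarrow> t \<ge> 0 \<Longrightarrow> x + t *\<^sub>R v \<in> U"
    and not_rec: "x0 \<in> U" "t0 \<ge> 0" "x0 - t0 *\<^sub>R v \<notin> U"
  shows "\<exists>T. \<forall>x\<in>U. \<forall>t\<ge>T. x + t *\<^sub>R v \<notin> ball 0 r"
proof (rule ccontr)
  assume "\<not> ?thesis"
  then have "\<forall>n::nat. \<exists>x t. x \<in> U \<and> t \<ge> real n \<and> x + t *\<^sub>R v \<in> ball 0 r" by meson
  then obtain x t where xt: "\<And>n. x n \<in> U" "\<And>n. t n \<ge> real n" "\<And>n. x n + t n *\<^sub>R v \<in> ball 0 r" by metis
  define b where "b n = x n + t n *\<^sub>R v" for n
  have "bounded (range b)"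
    by (rule bounded_subset[OF bounded_ball[of 0 r]]) (use xt(3) in \<open>auto simp: b_def\<close>)
  then obtain l \<sigma> where \<sigma>: "strict_mono \<sigma>" "(b \<circ> \<sigma>) \<longlonglongrightarrow> l"
    using bounded_imp_convergent_subsequence by blast
  have "l + s *\<^sub>R (- v) \<in> closure U" if "s \<ge> 0" for s
  proof (rule Lim_in_closed_set[OF closed_closure])
    show "(\<lambda>n. b (\<sigma> n) + s *\<^sub>R (- v)) \<longlonglongrightarrow> l + s *\<^sub>R (- v)"
      using \<sigma>(2) by (intro tendsto_add tendsto_const) (simp add: comp_def)
    obtain N :: nat where N: "real N \<ge> s" using real_arch_simple by blast
    have "b (\<sigma> n) + s *\<^sub>R (- v) \<in> closure U" if "n \<ge> N" for n
    proof -
      have "s \<le> t (\<sigma> n)"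
        using N that xt(2)[of "\<sigma> n"] seq_suble[OF \<sigma>(1), of n] by linarith
      then have "x (\<sigma> n) + (t (\<sigma> n) - s) *\<^sub>R v \<in> U" using rec xt(1) by simp
      then show ?thesis using closure_subset by (auto simp: b_def algebra_simps)
    qed
    then show "\<forall>\<^sub>F n in sequentially. b (\<sigma> n) + s *\<^sub>R (- v) \<in> closure U"
      by (auto simp: eventually_sequentially)
  qed simp
  from recession_from_closure[OF U _ this not_rec(1,2)] this[of 0] not_rec(3) show False by simp
qed

text \<open>Iterating a translation that preserves \<open>U\<close>, and its inverse, gives all
  integer multiples; convexity fills in the real ones.\<close>

lemma mem_stab_iff:
  fixes U :: "(real^'n::finite) set"
  assumes "convex U"
  shows "v \<in> stab U \<longleftrightarrow> (\<forall>x\<in>U. \<forall>t. x + t *\<^sub>R v \<in> U)"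
proof
  assume "v \<in> stab U"
  then have eq: "(\<lambda>u. u + v) ` U = U" by (simp add: stab_def)
  have step: "x + v \<in> U" "x - v \<in> U" if "x \<in> U" for x
  proof -
    show "x + v \<in> U" using eq that by blast
    have "x \<in> (\<lambda>u. u + v) ` U" using that by (simp only: eq)
    then show "x - v \<in> U" by auto
  qed
  show "\<forall>x\<in>U. \<forall>t. x + t *\<^sub>R v \<in> U"
  proof (intro ballI allI)
    fix x t assume x: "x \<in> U"
    have n: "x + real n *\<^sub>R v \<in> U" "x - real n *\<^sub>R v \<in> U" for n
    proof (induction n)
      case (Suc n)
      have "x + real (Suc n) *\<^sub>R v = (x + real n *\<^sub>R v) + v" "x - real (Suc n) *\<^sub>R v = (x - real n *\<^sub>R v) - v"
        by (simp_all add: algebra_simps)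
      then show "x + real (Suc n) *\<^sub>R v \<in> U" "x - real (Suc n) *\<^sub>R v \<in> U"
        using step(1)[OF Suc(1)] step(2)[OF Suc(2)] by (simp_all only:)
    qed (use x in simp_all)
    obtain n :: nat where "real n \<ge> \<bar>t\<bar>" using real_arch_simple by blast
    then have n0: "real (Suc n) > \<bar>t\<bar>" by simp
    let ?N = "real (Suc n)"
    \<comment> \<open>These weights write the point at parameter \<open>t\<close> as a convex
      combination of those at \<open>- ?N\<close> and \<open>?N\<close>; \<open>?N\<close> exceeds
      \<open>\<bar>t\<bar>\<close>, so they are nonnegative.\<close>
    have "((?N - t) / (2 * ?N)) *\<^sub>R (x - ?N *\<^sub>R v) + ((?N + t) / (2 * ?N)) *\<^sub>R (x + ?N *\<^sub>R v) \<in> U"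
      using n[of "Suc n"] n0 by (intro convexD[OF assms]) (auto simp: field_simps simp del: of_nat_Suc)
    moreover have "a *\<^sub>R (x - N *\<^sub>R v) + b *\<^sub>R (x + N *\<^sub>R v) = (a + b) *\<^sub>R x + (b * N - a * N) *\<^sub>R v" for a b N
      by (simp add: algebra_simps)
    moreover have "((?N - t) / (2 * ?N)) + ((?N + t) / (2 * ?N)) = 1"
      "((?N + t) / (2 * ?N)) * ?N - ((?N - t) / (2 * ?N)) * ?N = t"
      using n0 by (auto simp: field_simps simp del: of_nat_Suc)
    ultimately show "x + t *\<^sub>R v \<in> U" by (simp only: scaleR_one)
  qed
next
  assume *: "\<forall>x\<in>U. \<forall>t. x + t *\<^sub>R v \<in> U"
  have "x + v \<in> U" "x - v \<in> U" if "x \<in> U" for x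
    using *[rule_format, OF that, of 1] *[rule_format, OF that, of "-1"] by simp_all
  then have "(\<lambda>u. u + v) ` U = U"
    by (auto intro: image_eqI[where x = "_ - v"])
  then show "v \<in> stab U" by (simp add: stab_def)
qed

lemma subspace_stab:
  assumes "convex U" shows "subspace (stab U)"
proof (rule subspaceI)
  show "0 \<in> stab U" by (simp add: mem_stab_iff[OF assms])
  show "c *\<^sub>R v \<in> stab U" if "v \<in> stab U" for c v
    using that by (simp add: mem_stab_iff[OF assms])
  fix v w assume "v \<in> stab U" "w \<in> stab U"
  then have "(x + t *\<^sub>R v) + t *\<^sub>R w \<in> U" if "x \<in> U" for x t
    using that unfolding mem_stab_iff[OF assms] by blast
  then show "v + w \<in> stab U"
    by (simp add: mem_stab_iff[OF assms] scaleR_add_right add.assoc)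
qed

text \<open>The bounded set is the part of \<open>U\<close> orthogonal to \<open>stab U\<close>.
  Were it unbounded, the unit vectors towards its distant points would accumulate at a recession
  direction \<open>l\<close>, which lies in \<open>stab U\<close> by \<open>rec\<close> and is also
  orthogonal to it, although its norm is 1.\<close>

lemma bounded_mod_stab:
  fixes U :: "(real^'n::finite) set"
  assumes U: "convex U" "open U"
    and rec: "\<And>v. (\<And>x t. x \<in> U \<Longrightarrow> t \<ge> 0 \<Longrightarrow> x + t *\<^sub>R v \<in> U) \<Longrightarrow> v \<in> stab U"
  shows "\<exists>B. bounded B \<and> U \<subseteq> {b + s | b s. b \<in> B \<and> s \<in> stab U}"
proof (intro exI conjI)
  let ?S = "stab U" and ?B = "{x\<in>U. \<forall>s\<in>stab U. x \<bullet> s = 0}"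
  have S: "subspace ?S" by (rule subspace_stab[OF U(1)])
  show "U \<subseteq> {b + s | b s. b \<in> ?B \<and> s \<in> ?S}"
  proof
    fix x assume x: "x \<in> U"
    obtain s y where sy: "s \<in> span ?S" "\<And>w. w \<in> span ?S \<Longrightarrow> orthogonal y w" "x = s + y"
      using orthogonal_subspace_decomp_exists[of ?S x] by metis
    have span: "span ?S = ?S" using S by (simp add: span_eq_iff)
    have "x + (-1) *\<^sub>R s \<in> U" using x sy(1) mem_stab_iff[OF U(1), of s] span by blast
    then have "y \<in> ?B" using sy span by (auto simp: orthogonal_def)
    then show "x \<in> {b + s | b s. b \<in> ?B \<and> s \<in> ?S}" using sy(1,3) span
      by (intro CollectI exI[of _ y] exI[of _ s]) (auto simp: add.commute)
  qed
  show "bounded ?B"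
  proof (rule ccontr)
    assume "\<not> bounded ?B"
    then have "\<forall>n::nat. \<exists>x. x \<in> ?B \<and> norm x > real n"
      unfolding bounded_iff by (metis (no_types, lifting) not_le)
    from choice[OF this] obtain b where b: "\<And>n. b n \<in> ?B" "\<And>n. norm (b n) > real n" by blast
    have pos: "norm (b n) > 0" for n using b(2)[of n] by (smt (verit) of_nat_0_le_iff)
    define u where "u n = b n /\<^sub>R norm (b n)" for n
    have norm_u: "norm (u n) = 1" for n using pos[of n] by (simp add: u_def)
    have "bounded (range u)" using norm_u by (auto simp: bounded_iff)
    then obtain l \<sigma> where \<sigma>: "strict_mono \<sigma>" "(u \<circ> \<sigma>) \<longlonglongrightarrow> l"
      using bounded_imp_convergent_subsequence by blast
    have "norm l = 1"
      using tendsto_norm[OF \<sigma>(2)] norm_u by (simp add: comp_def LIMSEQ_const_iff)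
    have inv0: "(\<lambda>n. inverse (norm (b n))) \<longlonglongrightarrow> 0"
    proof (rule tendsto_inverse_0_at_top, rule filterlim_at_top_mono[OF filterlim_real_sequentially])
      show "\<forall>\<^sub>F n in sequentially. real n \<le> norm (b n)"
        using b(2) by (auto intro!: always_eventually less_imp_le)
    qed
    have inv\<sigma>: "(\<lambda>n. inverse (norm (b (\<sigma> n)))) \<longlonglongrightarrow> 0"
      using LIMSEQ_subseq_LIMSEQ[OF inv0 \<sigma>(1)] by (simp add: comp_def)
    have b0: "b 0 \<in> closure U" using b(1)[of 0] closure_subset by blast
    have "b 0 + t *\<^sub>R l \<in> closure U" if "t \<ge> 0" for t
    proof (rule Lim_in_closed_set[OF closed_closure])
      \<comment> \<open>Unfolding \<open>u\<close> shows a point of the segment from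
        \<open>b 0\<close> to \<open>b (\<sigma> n)\<close>, with weight \<open>t\<close> divided by
        the norm; this weight is at most 1 for large \<open>n\<close> and tends to 0.\<close>
      let ?y = "\<lambda>n. (1 - t * inverse (norm (b (\<sigma> n)))) *\<^sub>R b 0 + t *\<^sub>R u (\<sigma> n)"
      have "?y \<longlonglongrightarrow> (1 - t * 0) *\<^sub>R b 0 + t *\<^sub>R l"
        using \<sigma>(2) by (intro tendsto_intros inv\<sigma>) (simp add: comp_def)
      then show "?y \<longlonglongrightarrow> b 0 + t *\<^sub>R l" by simp
      obtain N :: nat where N: "real N \<ge> t" using real_arch_simple by blast
      have "?y n \<in> closure U" if "n \<ge> N" for n
      proof -
        let ?a = "t * inverse (norm (b (\<sigma> n)))"
        have "t \<le> norm (b (\<sigma> n))"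
          using N that b(2)[of "\<sigma> n"] seq_suble[OF \<sigma>(1), of n] by linarith
        then have "0 \<le> ?a" "?a \<le> 1" using \<open>t \<ge> 0\<close> pos[of "\<sigma> n"] by (auto simp: field_simps)
        then have "(1 - ?a) *\<^sub>R b 0 + ?a *\<^sub>R b (\<sigma> n) \<in> U"
          using b(1) by (intro convexD[OF U(1)]) auto
        then show ?thesis using closure_subset by (auto simp: u_def)
      qed
      then show "\<forall>\<^sub>F n in sequentially. ?y n \<in> closure U" by (auto simp: eventually_sequentially)
    qed simp
    then have "l \<in> ?S" using recession_from_closure[OF U b0] by (intro rec) blast
    moreover have "l \<bullet> s = 0" if "s \<in> ?S" for s
    proof -
      have "u n \<bullet> s = 0" for n using b(1)[of n] that by (simp add: u_def)
      then show ?thesis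
        using tendsto_inner[OF \<sigma>(2) tendsto_const[of s]] by (simp add: comp_def LIMSEQ_const_iff)
    qed
    ultimately have "l \<bullet> l = 0" by blast
    then show False using \<open>norm l = 1\<close> by simp
  qed
qed

text \<open>Decompose the points of the ray at times \<open>Suc n\<close> into a bounded part and a
  part in the stabiliser. Dividing by the time kills the bounded part, so \<open>v\<close> is a
  limit of stabiliser elements, and subspaces are closed.\<close>

lemma recession_in_stab_if_bounded_mod_stab:
  fixes U :: "(real^'n::finite) set"
  assumes U: "convex U" "x \<in> U" and rec: "\<And>t. t \<ge> 0 \<Longrightarrow> x + t *\<^sub>R v \<in> U"
    and B: "bounded B" "U \<subseteq> {b + s | b s. b \<in> B \<and> s \<in> stab U}"
  shows "v \<in> stab U"
proof -
  have S: "subspace (stab U)" by (rule subspace_stab[OF U(1)])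
  have "\<forall>n. \<exists>b s. x + real (Suc n) *\<^sub>R v = b + s \<and> b \<in> B \<and> s \<in> stab U"
    using rec B(2) by (auto simp: subset_eq)
  then obtain b s where bs: "\<And>n. x + real (Suc n) *\<^sub>R v = b n + s n" "\<And>n. b n \<in> B" "\<And>n. s n \<in> stab U"
    by metis
  obtain M where M: "\<And>y. y \<in> B \<Longrightarrow> norm y \<le> M" using B(1) bounded_iff by metis
  have "(\<lambda>n. inverse (real (Suc n)) *\<^sub>R (b n - x)) \<longlonglongrightarrow> 0"
  proof (rule Lim_null_comparison)
    have "norm (b n - x) \<le> M + norm x" for n
      using M[OF bs(2)[of n]] norm_triangle_ineq4[of "b n" x] by linarith
    then show "\<forall>\<^sub>F n in sequentially. norm (inverse (real (Suc n)) *\<^sub>R (b n - x)) \<le> inverse (real (Suc n)) * (M + norm x)"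
      by (intro always_eventually allI) (auto intro!: mult_left_mono simp del: of_nat_Suc)
    show "(\<lambda>n. inverse (real (Suc n)) * (M + norm x)) \<longlonglongrightarrow> 0"
      using tendsto_mult_right[OF LIMSEQ_inverse_real_of_nat, of "M + norm x"] by simp
  qed
  from tendsto_diff[OF tendsto_const[of v] this]
  have "(\<lambda>n. v - inverse (real (Suc n)) *\<^sub>R (b n - x)) \<longlonglongrightarrow> v" by simp
  moreover have "v - inverse (real (Suc n)) *\<^sub>R (b n - x) = inverse (real (Suc n)) *\<^sub>R s n" for n
  proof -
    have "s n = real (Suc n) *\<^sub>R v - (b n - x)" using bs(1)[of n] by (simp add: algebra_simps del: of_nat_Suc)
    then show ?thesis by (simp add: scaleR_diff_right del: of_nat_Suc)
  qed
  ultimately have "(\<lambda>n. inverse (real (Suc n)) *\<^sub>R s n) \<longlonglongrightarrow> v" by simp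
  then show ?thesis
    by (rule closed_sequentially[OF closed_subspace[OF S] subspace_mul[OF S bs(3)]])
qed

theorem mainTheorem7:
  fixes U :: "(real^'n::finite) set" and k :: nat
  assumes "convex U" and "open U"
  shows "(deg U = Some k \<longrightarrow> Hbs_iso_R U k) \<and> (deg U \<noteq> Some k \<longrightarrow> Hbs_zero U k)"
proof (cases "\<exists>v. (\<forall>x\<in>U. \<forall>t\<ge>0. x + t *\<^sub>R v \<in> U) \<and> v \<notin> stab U")
  case True
  then obtain v where rec: "\<And>x t. x \<in> U \<Longrightarrow> 0 \<le> t \<Longrightarrow> x + t *\<^sub>R v \<in> U" and v: "v \<notin> stab U" by blast
  obtain x t where x: "x \<in> U" "x + t *\<^sub>R v \<notin> U" using v mem_stab_iff[OF assms(1)] by blast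
  \<comment> \<open>Forward translation never leaves \<open>U\<close>, so the exit found here is
    along \<open>- v\<close>, as the escape lemma demands.\<close>
  then have "t < 0" using rec by (meson not_le)
  then have "\<exists>T. \<forall>x\<in>U. \<forall>t\<ge>T. x + t *\<^sub>R v \<notin> ball 0 r" for r
    using escape_if_not_reverse_recession[OF assms rec x(1), of "- t"] x(2) by simp
  from Hbs_zero_if_translation_escapes[OF assms(2) rec this] have "Hbs_zero U k" .
  moreover have "deg U = None"
    using recession_in_stab_if_bounded_mod_stab[OF assms(1) x(1) rec[OF x(1)]] v by (auto simp: deg_def)
  ultimately show ?thesis by simp
next
  case False
  then obtain B where B: "bounded B" "U \<subseteq> {b + s | b s. b \<in> B \<and> s \<in> stab U}"
    using bounded_mod_stab[OF assms] by blast
  show ?thesis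
  proof (cases "U = {}")
    case True
    \<comment> \<open>On the empty set the escape condition is vacuous, so even the zero direction
      serves.\<close>
    then have "Hbs_zero U k" by (intro Hbs_zero_if_translation_escapes[of U 0]) auto
    then show ?thesis using True by (simp add: deg_def)
  next
    case nonempty: False
    have "x + s \<in> U" if "x \<in> U" "s \<in> stab U" for x s
      using mem_stab_iff[OF assms(1), of s] that by (metis scaleR_one)
    from Hbs_bounded_mod_subspace[OF assms(2,1) nonempty subspace_stab[OF assms(1)] this B]
    have "Hbs_iso_R U (dim (stab U)) \<and> (\<forall>k. k \<noteq> dim (stab U) \<longrightarrow> Hbs_zero U k)" .
    moreover have "deg U = Some (dim (stab U))"
      using nonempty B unfolding deg_def by meson
    ultimately show ?thesis by auto
  qed
qed

end
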